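(* Suppose that every infinite profinite group is nice. Then every nondiscrete locally compact group in which every open subgroup is of index at most $\mathrm{cof}(\mathcal{N})$ is also nice; that is, there exists a compact set $C$ of Haar measure zero in the group such that the group can be covered by $\mathrm{cof}(\mathcal{N})$ many left translates of $C$.
   Context: All topological groups are assumed to be Hausdorff. $\mathcal{N}$ denotes the family of Lebesgue null subsets of the real line $\mathbb{R}$, and $\mathrm{cof}(\mathcal{N})=\min\{|\mathcal{H}| : \mathcal{H}\subset\mathcal{N},\ \forall N\in\mathcal{N}\ \exists H\in\mathcal{H}\ N\subset H\}$. A locally compact group $G$ (not necessarily abelian) is called nice if there exists a compact set $C\subset G$ of Haar measure zero such that $G$ can be covered by $\mathrm{cof}(\mathcal{N})$ many left translates of $C$, i.e. $G=\bigcup_{a\in A} aC$ for some $A\subset G$ with $|A|\le\mathrm{cof}(\mathcal{N})$. (A set has left Haar measure zero iff it has right Haar measure zero.) A profinite group is an inverse limit of finite (discrete) groups. *)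

theory Defs
  imports "HOL-Analysis.Analysis" "HOL-Algebra.Product_Groups"
begin

unbundle cardinal_syntax

section \<open>Topological groups\<close>

text \<open>A topological group is a group \<open>G\<close> together with a topology \<open>T\<close> on its carrier.
  All topological groups are Hausdorff by convention.\<close>

definition topological_group :: "'a monoid \<Rightarrow> 'a topology \<Rightarrow> bool" where
  "topological_group G T \<longleftrightarrow>
     group G \<and> topspace T = carrier G \<and> Hausdorff_space T \<and>
     continuous_map (prod_topology T T) T (\<lambda>(x, y). x \<otimes>\<^bsub>G\<^esub> y) \<and>
     continuous_map T T (\<lambda>x. inv\<^bsub>G\<^esub> x)"

definition locally_compact_group :: "'a monoid \<Rightarrow> 'a topology \<Rightarrow> bool" where
  "locally_compact_group G T \<longleftrightarrow> topological_group G T \<and> locally_compact_space T"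

definition topological_group_iso ::
    "'a monoid \<Rightarrow> 'a topology \<Rightarrow> 'b monoid \<Rightarrow> 'b topology \<Rightarrow> ('a \<Rightarrow> 'b) \<Rightarrow> bool" where
  "topological_group_iso G T H S h \<longleftrightarrow> h \<in> iso G H \<and> homeomorphic_map T S h"


section \<open>Profinite groups\<close>

definition inverse_system ::
    "'i set \<Rightarrow> 'i rel \<Rightarrow> ('i \<Rightarrow> 'g monoid) \<Rightarrow> ('i \<Rightarrow> 'i \<Rightarrow> 'g \<Rightarrow> 'g) \<Rightarrow> bool" where
  "inverse_system I R F \<phi> \<longleftrightarrow>
     I \<noteq> {} \<and> partial_order_on I R \<and>
     (\<forall>i\<in>I. \<forall>j\<in>I. \<exists>k\<in>I. (i, k) \<in> R \<and> (j, k) \<in> R) \<and>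
     (\<forall>i\<in>I. group (F i)) \<and>
     (\<forall>i j. (i, j) \<in> R \<longrightarrow> \<phi> i j \<in> hom (F j) (F i)) \<and>
     (\<forall>i\<in>I. \<forall>x\<in>carrier (F i). \<phi> i i x = x) \<and>
     (\<forall>i j k. (i, j) \<in> R \<longrightarrow> (j, k) \<in> R \<longrightarrow>
        (\<forall>x\<in>carrier (F k). \<phi> i j (\<phi> j k x) = \<phi> i k x))"

definition inverse_limit_carrier ::
    "'i set \<Rightarrow> 'i rel \<Rightarrow> ('i \<Rightarrow> 'g monoid) \<Rightarrow> ('i \<Rightarrow> 'i \<Rightarrow> 'g \<Rightarrow> 'g) \<Rightarrow> ('i \<Rightarrow> 'g) set" where
  "inverse_limit_carrier I R F \<phi> =
     {x \<in> carrier (product_group I F). \<forall>i j. (i, j) \<in> R \<longrightarrow> \<phi> i j (x j) = x i}"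

definition inverse_limit_group ::
    "'i set \<Rightarrow> 'i rel \<Rightarrow> ('i \<Rightarrow> 'g monoid) \<Rightarrow> ('i \<Rightarrow> 'i \<Rightarrow> 'g \<Rightarrow> 'g) \<Rightarrow> ('i \<Rightarrow> 'g) monoid" where
  "inverse_limit_group I R F \<phi> = (product_group I F)\<lparr>carrier := inverse_limit_carrier I R F \<phi>\<rparr>"

text \<open>The factors carry the discrete topology.\<close>

definition inverse_limit_topology ::
    "'i set \<Rightarrow> 'i rel \<Rightarrow> ('i \<Rightarrow> 'g monoid) \<Rightarrow> ('i \<Rightarrow> 'i \<Rightarrow> 'g \<Rightarrow> 'g) \<Rightarrow> ('i \<Rightarrow> 'g) topology" where
  "inverse_limit_topology I R F \<phi> =
     subtopology (product_topology (\<lambda>i. discrete_topology (carrier (F i))) I)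
       (inverse_limit_carrier I R F \<phi>)"

text \<open>HOL cannot quantify over types inside a formula, so the types of the indices and of the
  elements of the finite groups have to be chosen. Nothing is lost: every finite group is
  isomorphic to one whose elements are natural numbers, and an inverse limit of finite discrete
  groups is the inverse limit of its quotients by its open normal subgroups, which form an index
  set of type \<open>'a set set\<close>.\<close>

definition profinite_group :: "'a monoid \<Rightarrow> 'a topology \<Rightarrow> bool" where
  "profinite_group G T \<longleftrightarrow>
     topological_group G T \<and>
     (\<exists>(I :: 'a set set) R (F :: 'a set \<Rightarrow> nat monoid) \<phi>.
        inverse_system I R F \<phi> \<and> (\<forall>i\<in>I. finite (carrier (F i))) \<and>
        (\<exists>h. topological_group_iso G T
               (inverse_limit_group I R F \<phi>) (inverse_limit_topology I R F \<phi>) h))"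


section \<open>Haar measure\<close>

text \<open>A left Haar measure is a nonzero left-invariant Radon measure on the Borel sets.\<close>

definition left_haar_measure :: "'a monoid \<Rightarrow> 'a topology \<Rightarrow> 'a measure \<Rightarrow> bool" where
  "left_haar_measure G T \<mu> \<longleftrightarrow>
     space \<mu> = topspace T \<and> sets \<mu> = sigma_sets (topspace T) {U. openin T U} \<and>
     emeasure \<mu> (space \<mu>) \<noteq> 0 \<and>
     (\<forall>g\<in>carrier G. \<forall>B\<in>sets \<mu>. emeasure \<mu> (g <#\<^bsub>G\<^esub> B) = emeasure \<mu> B) \<and>
     (\<forall>K. compactin T K \<longrightarrow> emeasure \<mu> K < \<infinity>) \<and>
     (\<forall>B\<in>sets \<mu>. emeasure \<mu> B = (INF U\<in>{U. openin T U \<and> B \<subseteq> U}. emeasure \<mu> U)) \<and>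
     (\<forall>U. openin T U \<longrightarrow> emeasure \<mu> U = (SUP K\<in>{K. compactin T K \<and> K \<subseteq> U}. emeasure \<mu> K))"

text \<open>A left Haar measure on a locally compact group exists and is unique up to a positive
  factor, so the choice of \<open>\<mu>\<close> is immaterial.\<close>

definition haar_null :: "'a monoid \<Rightarrow> 'a topology \<Rightarrow> 'a set \<Rightarrow> bool" where
  "haar_null G T B \<longleftrightarrow> (\<exists>\<mu>. left_haar_measure G T \<mu> \<and> B \<in> null_sets \<mu>)"


section \<open>The cofinality of the null ideal\<close>

definition cofinal_null_family :: "real set set \<Rightarrow> bool" where
  "cofinal_null_family \<H> \<longleftrightarrow>
     \<H> \<subseteq> null_sets lebesgue \<and> (\<forall>N\<in>null_sets lebesgue. \<exists>H\<in>\<H>. N \<subseteq> H)"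

text \<open>Cardinals are represented, as in the library, by well-order relations; the minimum is
  the cardinal of a cofinal family of least cardinality.\<close>

definition cof_null :: "real set rel" where
  "cof_null = |SOME \<H>. cofinal_null_family \<H> \<and> (\<forall>\<H>'. cofinal_null_family \<H>' \<longrightarrow> |\<H>| \<le>o |\<H>'| )|"

lemma cof_null_is_minimum:
  shows "\<exists>\<H>. cofinal_null_family \<H> \<and> cof_null = |\<H>|"
    and "cofinal_null_family \<H>' \<Longrightarrow> cof_null \<le>o |\<H>'|"
proof -
  let ?K = "card_of ` Collect cofinal_null_family"
  let ?P = "\<lambda>\<H>. cofinal_null_family \<H> \<and> (\<forall>\<H>'. cofinal_null_family \<H>' \<longrightarrow> |\<H>| \<le>o |\<H>'| )"
  have "cofinal_null_family (null_sets lebesgue)"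
    unfolding cofinal_null_family_def by blast
  then have "?K \<noteq> {}" by blast
  then have "\<exists>r\<in>?K. \<forall>r'\<in>?K. r \<le>o r'"
    by (rule exists_minim_Card_order) (auto intro: card_of_Card_order)
  then have "\<exists>\<H>. ?P \<H>" by auto
  then have "?P (SOME \<H>. ?P \<H>)" by (rule someI_ex)
  then show "\<exists>\<H>. cofinal_null_family \<H> \<and> cof_null = |\<H>|"
    and "cofinal_null_family \<H>' \<Longrightarrow> cof_null \<le>o |\<H>'|"
    unfolding cof_null_def by blast+
qed


section \<open>Nice groups\<close>

text \<open>The notion is meant for locally compact groups only. \<open>a <#\<^bsub>G\<^esub> C\<close> is the left translate
  of the set \<open>C\<close> by \<open>a\<close>.\<close>

definition nice :: "'a monoid \<Rightarrow> 'a topology \<Rightarrow> bool" where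
  "nice G T \<longleftrightarrow>
     (\<exists>C. compactin T C \<and> haar_null G T C \<and>
        (\<exists>A\<subseteq>carrier G. |A| \<le>o cof_null \<and> carrier G = (\<Union>a\<in>A. a <#\<^bsub>G\<^esub> C)))"

end

theory Submission
  imports Defs "HOL-Library.Nat_Bijection" "HOL-Library.Discrete_Functions"
begin

text \<open>Let \<open>K\<close> be compact and call a function assigning to each \<open>n\<close> a set of at most \<open>h n\<close> naturals a
  slalom. For every slowly growing \<open>h\<close>, some \<open>cof(\<N>)\<close> slaloms capture every sequence of naturals.
  Code the points of \<open>K\<close> by sequences, entry \<open>n\<close> naming a small open set of a finite cover of \<open>K\<close>.
  At stage \<open>n\<close> remove from a compact set \<open>C\<close> an open set \<open>B\<close> and choose \<open>h n + 1\<close> perturbations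
  close to the identity under which the preimages of \<open>B\<close> are disjoint. Each of the \<open>h n\<close> small open
  sets allowed by a slalom is then moved into \<open>B\<close> by at most one perturbation, so some perturbation
  avoids \<open>B\<close> on all of them; composing these perturbations, a single translation moves all points
  captured by the slalom into the final compact set. A greedy choice gives \<open>B\<close> at least the
  proportion \<open>1 / (2 (h n + 1)\<^sup>2)\<close> of the measure of \<open>C\<close>, and \<open>h\<close> can grow so slowly that the
  final set is null.\<close>

text \<open>The slaloms come from Bartoszynski's characterisation of cof(\<N>): a sequence is coded
  by a null set of reals, and any null set containing it gives back, by a Baire category argument,
  few candidates for each entry. The group need not be metrizable, so no countable family of open
  sets separates its points, and products of perturbations need not converge. Only one finite cover
  of \<open>K\<close> per stage enters, and a point common to nested compact sets replaces the
  limit. The final set, the covers and the candidate perturbations must be fixed before a slalom is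
  given, whereas the perturbations selected depend on it. Every stage therefore serves all the
  finitely many compositions of earlier candidates at once and leaves a margin for all later ones.
  The whole group is reached through the open subgroup generated by a neighbourhood inside a compact
  \<open>K\<close>: countably many translates of \<open>K\<close> cover this subgroup, and its index
  is at most cof(\<N>).\<close>

section \<open>Slaloms from null sets\<close>

text \<open>Up to a null set, \<open>digit_zero q k\<close> consists of the reals whose digit number \<open>k + 1\<close> after
  the point in base \<open>q\<close> is zero.\<close>

definition digit_zero :: "nat \<Rightarrow> nat \<Rightarrow> real set" where
  "digit_zero q k = (\<Union>a::int. {x. of_int a < real q ^ k * x \<and> real q ^ k * x < of_int a + 1 / real q})"

lemma open_digit_zero: "open (digit_zero q k)"
  unfolding digit_zero_def
  by (intro open_UN ballI open_Collect_conj open_Collect_less continuous_intros)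

lemma digit_zero_int_add: "x + of_int m \<in> digit_zero q k \<longleftrightarrow> x \<in> digit_zero q k"
proof -
  have "x + of_int m \<in> digit_zero q k" if x: "x \<in> digit_zero q k" for x and m :: int
  proof -
    obtain a :: int where a: "of_int a < real q ^ k * x" "real q ^ k * x < of_int a + 1 / real q"
      using x by (auto simp: digit_zero_def)
    have "real q ^ k * (x + of_int m) = real q ^ k * x + of_int (int q ^ k * m)"
      by (simp add: algebra_simps)
    then show ?thesis using a
      unfolding digit_zero_def by (intro UN_I[of "a + int q ^ k * m"]) (auto simp: algebra_simps)
  qed
  from this[of x m] this[of "x + of_int m" "- m"] show ?thesis by auto
qed

text \<open>Multiplication by \<open>q\<close> shifts the digits by one place. Together with
  periodicity under integers this lets the inductions below split off the leading digit.\<close>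

lemma digit_zero_scale: "x \<in> digit_zero q (Suc k) \<longleftrightarrow> real q * x \<in> digit_zero q k"
  by (simp add: digit_zero_def mult_ac)

lemma unit_interval_digit:
  assumes "q > 0" "x \<in> {0..<1::real}"
  obtains a y where "a < q" "y \<in> {0..<1}" "x = (1 / real q) *\<^sub>R y + real a / real q" "real q * x = y + real a"
proof -
  define a where "a = nat \<lfloor>real q * x\<rfloor>"
  have pos: "0 \<le> real q * x" "real q * x < real q" using assms by auto
  have a: "real a \<le> real q * x" "real q * x < real a + 1" using pos unfolding a_def by linarith+
  show ?thesis
  proof (rule that[of a "real q * x - real a"])
    show "a < q" using pos a by linarith
  qed (use a assms in \<open>auto simp: field_simps\<close>)
qed

text \<open>One copy of \<open>S\<close>, shrunk by 1/q, stands for each admissible leading digit in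
  \<open>A\<close>. The point 0 is exceptional because \<open>digit_zero\<close> is made of open
  intervals and misses it although all its digits are zero.\<close>

lemma digit_pieces_measure:
  assumes q: "q > 0" and A: "finite A" and S: "S \<in> sets lebesgue"
    and X: "X \<subseteq> insert 0 (\<Union>a\<in>A. (\<lambda>y. (1 / real q) *\<^sub>R y + real a / real q) ` S)"
  shows "emeasure lebesgue X \<le> ennreal (real (card A) / real q) * emeasure lebesgue S"
proof -
  let ?P = "\<lambda>a. (\<lambda>y. (1 / real q) *\<^sub>R y + real a / real q) ` S"
  have P: "?P a \<in> sets lebesgue" for a
  proof -
    show ?thesis
      by (intro differentiable_image_in_sets_lebesgue S) (use q in \<open>auto intro!: derivative_intros simp: differentiable_on_def\<close>)
  qed
  have UP: "(\<Union>a\<in>A. ?P a) \<in> sets lebesgue" using P A by (intro sets.finite_UN)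
  have "emeasure lebesgue X \<le> emeasure lebesgue (insert 0 (\<Union>a\<in>A. ?P a))"
    by (rule emeasure_mono[OF X sets.insert_in_sets[OF _ UP]]) simp
  also have "\<dots> = emeasure lebesgue ({0} \<union> (\<Union>a\<in>A. ?P a))" by simp
  also have "\<dots> \<le> emeasure lebesgue {0::real} + emeasure lebesgue (\<Union>a\<in>A. ?P a)"
    by (rule emeasure_subadditive[OF _ UP]) simp
  also have "\<dots> = emeasure lebesgue (\<Union>a\<in>A. ?P a)" by simp
  also have "\<dots> \<le> (\<Sum>a\<in>A. emeasure lebesgue (?P a))"
    using P A by (intro emeasure_subadditive_finite) auto
  also have "\<dots> = (\<Sum>a\<in>A. ennreal (1 / real q) * emeasure lebesgue S)"
    by (subst emeasure_lebesgue_affine) (simp add: q)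
  also have "\<dots> = ennreal (real (card A) / real q) * emeasure lebesgue S"
    by (simp add: mult.assoc[symmetric] ennreal_mult'[symmetric] ennreal_of_nat_eq_real_of_nat)
  finally show ?thesis .
qed

definition digits_nonzero :: "nat \<Rightarrow> nat set \<Rightarrow> real set" where
  "digits_nonzero q J = {x \<in> {0..<1}. \<forall>k\<in>J. x \<notin> digit_zero q k}"

lemma sets_digits_nonzero: "finite J \<Longrightarrow> digits_nonzero q J \<in> sets lebesgue"
proof -
  assume J: "finite J"
  have "digits_nonzero q J = {0..<1} - (\<Union>k\<in>J. digit_zero q k)"
    by (auto simp: digits_nonzero_def)
  moreover have "(\<Union>k\<in>J. digit_zero q k) \<in> sets borel"
    by (intro borel_open open_UN ballI open_digit_zero)
  ultimately show ?thesis by (auto intro!: sets.Diff)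
qed

text \<open>Distinct digits are independent, so each element of \<open>J\<close> contributes a
  factor 1 - 1/q. The induction removes the leading digit and lowers the remaining indices by one,
  which lowers the bound \<open>m\<close>.\<close>

lemma emeasure_digits_nonzero:
  assumes q: "q > 1" and J: "J \<subseteq> {..<m}"
  shows "emeasure lebesgue (digits_nonzero q J) \<le> ennreal ((1 - 1 / real q) ^ card J)"
  using J
proof (induction m arbitrary: J)
  case 0
  then have "J = {}" by auto
  moreover have "emeasure lebesgue (digits_nonzero q {}) \<le> emeasure lebesgue {0..1::real}"
    by (intro emeasure_mono) (auto simp: digits_nonzero_def)
  ultimately show ?case by simp
next
  case (Suc m)
  let ?J' = "{k. Suc k \<in> J}"
  \<comment> \<open>The admissible leading digits: zero is excluded exactly when \<open>J\<close>
    constrains the first place, which leaves q - 1 or q pieces.\<close>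
  let ?A = "if 0 \<in> J then {1..<q} else {..<q}"
  have J': "?J' \<subseteq> {..<m}" using Suc.prems by auto
  have fJ: "finite J" using Suc.prems finite_subset by blast
  have fJ': "finite ?J'" using J' finite_subset by blast
  have J_eq: "J = (if 0 \<in> J then insert 0 (Suc ` ?J') else Suc ` ?J')"
    by (auto simp: image_iff) (metis not0_implies_Suc)+
  have card_J: "card J = (if 0 \<in> J then Suc (card ?J') else card ?J')"
    by (subst J_eq) (simp add: fJ' card_image)
  have "digits_nonzero q J \<subseteq>
      insert 0 (\<Union>a\<in>?A. (\<lambda>y. (1 / real q) *\<^sub>R y + real a / real q) ` digits_nonzero q ?J')"
  proof
    fix x assume x: "x \<in> digits_nonzero q J"
    then have "x \<in> {0..<1}" by (simp add: digits_nonzero_def)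
    then obtain a y where ay: "a < q" "y \<in> {0..<1}" "x = (1 / real q) *\<^sub>R y + real a / real q"
      "real q * x = y + real a"
      using unit_interval_digit[of q x] q by auto
    have "y \<notin> digit_zero q k" if "Suc k \<in> J" for k
      using x that ay(4) digit_zero_scale[of x q k] digit_zero_int_add[of y "int a" q k]
      by (auto simp: digits_nonzero_def)
    then have y: "y \<in> digits_nonzero q ?J'" using ay by (simp add: digits_nonzero_def)
    show "x \<in> insert 0 (\<Union>a\<in>?A. (\<lambda>y. (1 / real q) *\<^sub>R y + real a / real q) ` digits_nonzero q ?J')"
    proof (cases "x = 0")
      case False
      have "a \<noteq> 0" if "0 \<in> J"
      proof
        assume "a = 0"
        then have "0 < x" "x < 1 / real q" using False \<open>x \<in> {0..<1}\<close> ay(2,3) q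
          by (simp_all add: divide_strict_right_mono)
        then have "x \<in> digit_zero q 0" unfolding digit_zero_def by (intro UN_I[of 0]) auto
        then show False using x that by (auto simp: digits_nonzero_def)
      qed
      then have "a \<in> ?A" using ay by auto
      then show ?thesis using y ay(3) by blast
    qed simp
  qed
  then have "emeasure lebesgue (digits_nonzero q J)
      \<le> ennreal (real (card ?A) / real q) * emeasure lebesgue (digits_nonzero q ?J')"
    using q sets_digits_nonzero[OF fJ'] by (intro digit_pieces_measure) auto
  also have "\<dots> \<le> ennreal (real (card ?A) / real q) * ennreal ((1 - 1 / real q) ^ card ?J')"
    by (intro mult_left_mono Suc.IH J') simp
  also have "\<dots> = ennreal (real (card ?A) / real q * (1 - 1 / real q) ^ card ?J')"
    using q by (intro ennreal_mult[symmetric]) auto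
  also have "real (card ?A) / real q * (1 - 1 / real q) ^ card ?J' = (1 - 1 / real q) ^ card J"
    using q unfolding card_J by (auto simp: field_simps of_nat_diff)
  finally show ?case .
qed

lemma emeasure_digit_zero:
  assumes q: "q > 1"
  shows "emeasure lebesgue (digit_zero q k \<inter> {0..<1}) \<le> ennreal (1 / real q)"
proof (induction k)
  case 0
  have "digit_zero q 0 \<inter> {0..<1} \<subseteq> {0..1 / real q}"
  proof
    fix x assume x: "x \<in> digit_zero q 0 \<inter> {0..<1}"
    then obtain a :: int where a: "of_int a < x" "x < of_int a + 1 / real q" "0 \<le> x" "x < 1"
      by (auto simp: digit_zero_def)
    have "1 / real q \<le> 1" using q by simp
    then have "a = 0" using a by linarith
    then show "x \<in> {0..1 / real q}" using a by simp
  qed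
  then have "emeasure lebesgue (digit_zero q 0 \<inter> {0..<1}) \<le> emeasure lebesgue {0..1 / real q}"
    by (intro emeasure_mono) auto
  then show ?case by simp
next
  case (Suc k)
  have sets: "digit_zero q k \<inter> {0..<1} \<in> sets lebesgue"
    using borel_open[OF open_digit_zero] by auto
  have "digit_zero q (Suc k) \<inter> {0..<1} \<subseteq>
      insert 0 (\<Union>a\<in>{..<q}. (\<lambda>y. (1 / real q) *\<^sub>R y + real a / real q) ` (digit_zero q k \<inter> {0..<1}))"
  proof
    fix x assume x: "x \<in> digit_zero q (Suc k) \<inter> {0..<1}"
    then obtain a y where ay: "a < q" "y \<in> {0..<1}" "x = (1 / real q) *\<^sub>R y + real a / real q"
      "real q * x = y + real a"
      using unit_interval_digit[of q x] q by auto
    have "y \<in> digit_zero q k"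
      using x ay(4) digit_zero_scale[of x q k] digit_zero_int_add[of y "int a" q k] by auto
    then show "x \<in> insert 0 (\<Union>a\<in>{..<q}. (\<lambda>y. (1 / real q) *\<^sub>R y + real a / real q) ` (digit_zero q k \<inter> {0..<1}))"
      using ay by blast
  qed
  then have "emeasure lebesgue (digit_zero q (Suc k) \<inter> {0..<1})
      \<le> ennreal (real (card {..<q}) / real q) * emeasure lebesgue (digit_zero q k \<inter> {0..<1})"
    using q by (intro digit_pieces_measure sets) auto
  also have "\<dots> = emeasure lebesgue (digit_zero q k \<inter> {0..<1})" using q by simp
  also have "\<dots> \<le> ennreal (1 / real q)" by (rule Suc.IH)
  finally show ?case .
qed

text \<open>Avoiding \<open>b n\<close> independent events of probability 2^-(n+1) has probability
  (1 - 2^-(n+1))^(b n), and \<open>b\<close> is chosen to bring this below 1/(n+1). A set of at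
  least that measure can thus avoid only few of them.\<close>

lemma digit_zero_level_bound:
  obtains b :: "nat \<Rightarrow> nat" where
    "\<And>n K J. K \<subseteq> {0..<1} \<Longrightarrow> ennreal (1 / real (Suc n)) \<le> emeasure lebesgue K \<Longrightarrow>
       (\<And>k. k \<in> J \<Longrightarrow> K \<inter> digit_zero (2 ^ Suc n) k = {}) \<Longrightarrow> finite J \<and> card J \<le> b n"
proof -
  have "\<exists>b. (1 - 1 / real (2 ^ Suc n)) ^ b < 1 / real (Suc n)" for n
    by (rule real_arch_pow_inv) auto
  then obtain b where b: "\<And>n. (1 - 1 / real (2 ^ Suc n)) ^ b n < 1 / real (Suc n)" by metis
  show ?thesis
  proof (rule that[of b], rule ccontr)
    fix n J and K :: "real set"
    assume K: "K \<subseteq> {0..<1}" "ennreal (1 / real (Suc n)) \<le> emeasure lebesgue K"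
      "\<And>k. k \<in> J \<Longrightarrow> K \<inter> digit_zero (2 ^ Suc n) k = {}"
      and "\<not> (finite J \<and> card J \<le> b n)"
    then have "infinite J \<or> b n \<le> card J" by linarith
    then have "\<exists>J0. finite J0 \<and> J0 \<subseteq> J \<and> card J0 = b n"
    proof
      assume "infinite J"
      then show ?thesis using infinite_arbitrarily_large by metis
    next
      assume "b n \<le> card J"
      then show ?thesis using obtain_subset_with_card_n by metis
    qed
    then obtain J0 where J0: "finite J0" "J0 \<subseteq> J" "card J0 = b n" by blast
    obtain m where m: "J0 \<subseteq> {..<m}" using J0 finite_nat_iff_bounded by auto
    have "ennreal (1 / real (Suc n)) \<le> emeasure lebesgue K" by (rule K)
    also have "\<dots> \<le> emeasure lebesgue (digits_nonzero (2 ^ Suc n) J0)"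
    proof (rule emeasure_mono)
      show "K \<subseteq> digits_nonzero (2 ^ Suc n) J0"
        using K(1,3) J0(2) unfolding digits_nonzero_def by blast
    qed (rule sets_digits_nonzero[OF J0(1)])
    also have "\<dots> \<le> ennreal ((1 - 1 / real (2 ^ Suc n)) ^ b n)"
      unfolding J0(3)[symmetric] by (rule emeasure_digits_nonzero[OF _ m]) (rule one_less_power, auto)
    also have "\<dots> < ennreal (1 / real (Suc n))"
      by (rule ennreal_lessI[OF _ b]) simp
    finally show False by simp
  qed
qed

text \<open>The complement of \<open>H\<close> contains a closed set of positive measure; deleting
  the basic open sets that meet it in a null set leaves the support of the restricted measure. Since
  every portion has positive measure, a portion found by category can later be exploited by
  measure.\<close>

lemma closed_avoiding_null_set:
  assumes H: "H \<in> null_sets lebesgue"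
  obtains C :: "real set" where "closed C" "C \<noteq> {}" "C \<subseteq> {0..<1} - H"
    "\<And>U. open U \<Longrightarrow> U \<inter> C \<noteq> {} \<Longrightarrow> 0 < emeasure lebesgue (C \<inter> U)"
proof -
  let ?S = "{0..<1::real} - H"
  have S: "?S \<in> sets lebesgue" using H by (intro sets.Diff) auto
  have eS: "emeasure lebesgue ?S = 1"
    by (subst emeasure_Diff_null_set[OF H]) simp_all
  obtain C where C: "closed C" "C \<subseteq> ?S" "emeasure lebesgue (?S - C) < ennreal (1/2)"
    by (rule sets_lebesgue_inner_closed[OF S, of "1/2"]) auto
  have Cs: "C \<in> sets lebesgue" using C(1) by auto
  have eC: "0 < emeasure lebesgue C"
  proof (rule ccontr)
    assume "\<not> 0 < emeasure lebesgue C"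
    then have "C \<in> null_sets lebesgue" using Cs by (auto simp: null_sets_def)
    then have "emeasure lebesgue (?S - C) = 1" using emeasure_Diff_null_set[OF _ S] eS by simp
    then have "1 < ennreal (1/2)" using C(3) by simp
    moreover have "ennreal (1/2) \<le> ennreal 1" by (rule ennreal_leI) simp
    ultimately show False by simp
  qed
  obtain B :: "real set set" where B: "countable B" "topological_basis B"
    using ex_countable_basis by blast
  define N where "N = \<Union>{b \<in> B. emeasure lebesgue (C \<inter> b) = 0}"
  have oN: "open N" unfolding N_def by (intro open_Union) (use B topological_basis_open in auto)
  have "C \<inter> N = (\<Union>b\<in>{b \<in> B. emeasure lebesgue (C \<inter> b) = 0}. C \<inter> b)" by (auto simp: N_def)
  also have "\<dots> \<in> null_sets lebesgue"
  proof (rule null_sets_UN')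
    show "countable {b \<in> B. emeasure lebesgue (C \<inter> b) = 0}" using B(1) by simp
    fix b assume b: "b \<in> {b \<in> B. emeasure lebesgue (C \<inter> b) = 0}"
    then have "open b" using B topological_basis_open by auto
    then have "C \<inter> b \<in> sets lebesgue" using Cs by auto
    then show "C \<inter> b \<in> null_sets lebesgue" using b by (auto simp: null_sets_def)
  qed
  finally have null: "C \<inter> N \<in> null_sets lebesgue" .
  have CN: "emeasure lebesgue ((C - N) \<inter> U) = emeasure lebesgue (C \<inter> U)" if "open U" for U
  proof -
    have "C \<inter> U \<in> sets lebesgue" using that Cs by auto
    moreover have "(C - N) \<inter> U = (C \<inter> U) - (C \<inter> N)" by auto
    ultimately show ?thesis using emeasure_Diff_null_set[OF null] by simp
  qed
  show ?thesis
  proof (rule that)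
    show "closed (C - N)" using C(1) oN by (rule closed_Diff)
    show "C - N \<subseteq> ?S" using C(2) by auto
    have "emeasure lebesgue (C - N) \<noteq> 0" using CN[of UNIV] eC by simp
    then show "C - N \<noteq> {}" by (metis emeasure_empty)
    fix U :: "real set" assume U: "open U" "U \<inter> (C - N) \<noteq> {}"
    then obtain x where x: "x \<in> U" "x \<in> C" "x \<notin> N" by auto
    obtain b where b: "b \<in> B" "x \<in> b" "b \<subseteq> U" using topological_basisE[OF B(2) U(1) x(1)] by metis
    have "open b" using B b topological_basis_open by auto
    have "0 < emeasure lebesgue (C \<inter> b)"
      using x b by (auto simp: N_def zero_less_iff_neq_zero)
    also have "\<dots> \<le> emeasure lebesgue (C \<inter> U)" using b Cs U by (intro emeasure_mono) auto
    finally show "0 < emeasure lebesgue ((C - N) \<inter> U)" using CN[OF U(1)] by simp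
  qed
qed

text \<open>The null set that codes the sequence \<open>f\<close>. The base grows with
  \<open>n\<close> so that the events have probability at most 2^-(n+1); these are summable, as
  Borel-Cantelli requires.\<close>

definition digit_limsup :: "(nat \<Rightarrow> nat) \<Rightarrow> real set" where
  "digit_limsup f = limsup (\<lambda>n. digit_zero (2 ^ Suc n) (f n) \<inter> {0..<1})"

lemma digit_limsup_null: "digit_limsup f \<in> null_sets lebesgue"
  unfolding digit_limsup_def
proof (rule borel_cantelli_limsup1)
  have le: "emeasure lebesgue (digit_zero (2 ^ Suc n) (f n) \<inter> {0..<1}) \<le> ennreal ((1/2) ^ Suc n)" for n
  proof -
    have "1 < (2::nat) ^ Suc n" by (rule one_less_power) auto
    moreover have "1 / real (2 ^ Suc n) = (1/2) ^ Suc n" by (simp add: power_one_over)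
    ultimately show ?thesis using emeasure_digit_zero[of "2 ^ Suc n" "f n"] by metis
  qed
  then show "emeasure lebesgue (digit_zero (2 ^ Suc n) (f n) \<inter> {0..<1}) < \<infinity>" for n
    using le_less_trans[OF le ennreal_less_top] by simp
  show "digit_zero (2 ^ Suc n) (f n) \<inter> {0..<1} \<in> sets lebesgue" for n
    using borel_open[OF open_digit_zero] by auto
  show "summable (\<lambda>n. measure lebesgue (digit_zero (2 ^ Suc n) (f n) \<inter> {0..<1}))"
  proof (rule summable_comparison_test[OF _ summable_geometric[of "1/2::real", THEN summable_ignore_initial_segment[of _ 1]]])
    have "measure lebesgue (digit_zero (2 ^ Suc n) (f n) \<inter> {0..<1}) \<le> (1/2) ^ (n + 1)" for n
      unfolding measure_def using enn2real_mono[OF le[of n]] by simp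
    then show "\<exists>N. \<forall>n\<ge>N. norm (measure lebesgue (digit_zero (2 ^ Suc n) (f n) \<inter> {0..<1})) \<le> (1/2) ^ (n + 1)"
      by simp
  qed simp
qed

section \<open>Cardinal bounds and the capture of sequences by slaloms\<close>

lemma countable_ordLeq_infinite:
  assumes "countable A" "infinite B" shows "|A| \<le>o |B|"
proof -
  obtain f :: "'a \<Rightarrow> nat" where "inj_on f A" using assms(1) by (rule countableE)
  then have "|A| \<le>o |UNIV :: nat set|" using card_of_ordLeq[of A "UNIV :: nat set"] by blast
  also have "|UNIV :: nat set| \<le>o |B|" using assms(2) infinite_iff_card_of_nat by blast
  finally show ?thesis .
qed

lemma Times_ordLeq_infinite:
  assumes "infinite C" "|A| \<le>o |C|" "|B| \<le>o |C|" shows "|A \<times> B| \<le>o |C|"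
  by (rule card_of_Times_ordLeq_infinite_Field[OF _ assms(2,3) card_of_Card_order])
    (simp add: Field_card_of assms(1))

text \<open>Singletons are null, so the union of a cofinal family is the whole line; a finite family
  would make it null. Infinity of the cofinality lets countable factors and products be
  absorbed.\<close>

lemma infinite_cofinal_null_family:
  assumes "cofinal_null_family \<H>" shows "infinite \<H>"
proof
  assume "finite \<H>"
  then have "\<Union>\<H> \<in> null_sets lebesgue"
    using assms unfolding cofinal_null_family_def
    by (intro null_sets.finite_Union) auto
  moreover have "\<Union>\<H> = UNIV"
  proof -
    have "{x} \<in> null_sets lebesgue" for x :: real
      using negligible_sing negligible_iff_null_sets by blast
    then have "\<exists>H\<in>\<H>. {x} \<subseteq> H" for x :: real
      using assms unfolding cofinal_null_family_def by blast
    then show ?thesis by blast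
  qed
  ultimately show False by (auto simp: null_sets_def)
qed

text \<open>Some \<open>H\<close> in a cofinal family contains \<open>digit_limsup f\<close>. The
  closed set attached to \<open>H\<close> misses this limsup, so by Baire's theorem some basic open
  \<open>U\<close> cuts out a portion that avoids the sets
  \<open>digit_zero (2 ^ Suc n) (f n)\<close> for all \<open>n\<close> \<ge> \<open>m\<close>. The
  positive measure of the portion leaves few candidates for \<open>f n\<close> once \<open>n\<close>
  is large. The slaloms depend only on the pair of \<open>H\<close> and \<open>U\<close>.\<close>

lemma eventual_slaloms:
  obtains b :: "nat \<Rightarrow> nat" and \<T> :: "(nat \<Rightarrow> nat set) set" where
    "|\<T>| \<le>o cof_null" "\<And>S n. S \<in> \<T> \<Longrightarrow> finite (S n) \<and> card (S n) \<le> b n"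
    "\<And>f. \<exists>S\<in>\<T>. \<exists>m. \<forall>n>m. f n \<in> S n"
proof -
  obtain \<H> where \<H>: "cofinal_null_family \<H>" "cof_null = |\<H>|"
    using cof_null_is_minimum(1) by blast
  obtain b where b: "\<And>n K J. K \<subseteq> {0..<1} \<Longrightarrow> ennreal (1 / real (Suc n)) \<le> emeasure lebesgue K \<Longrightarrow>
       (\<And>k. k \<in> J \<Longrightarrow> K \<inter> digit_zero (2 ^ Suc n) k = {}) \<Longrightarrow> finite J \<and> card J \<le> b n"
    using digit_zero_level_bound by metis
  have "\<forall>H\<in>\<H>. \<exists>C. closed C \<and> C \<noteq> {} \<and> C \<subseteq> {0..<1} - H \<and>
    (\<forall>U. open U \<longrightarrow> U \<inter> C \<noteq> {} \<longrightarrow> 0 < emeasure lebesgue (C \<inter> U))"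
    using \<H>(1) closed_avoiding_null_set unfolding cofinal_null_family_def by (metis subsetD)
  then obtain C where C: "\<And>H. H \<in> \<H> \<Longrightarrow> closed (C H)" "\<And>H. H \<in> \<H> \<Longrightarrow> C H \<noteq> {}"
    "\<And>H. H \<in> \<H> \<Longrightarrow> C H \<subseteq> {0..<1} - H"
    "\<And>H U. H \<in> \<H> \<Longrightarrow> open U \<Longrightarrow> U \<inter> C H \<noteq> {} \<Longrightarrow> 0 < emeasure lebesgue (C H \<inter> U)"
    by metis
  obtain B :: "real set set" where B: "countable B" "topological_basis B"
    using ex_countable_basis by blast
  define J where "J H U n = {k. C H \<inter> U \<inter> digit_zero (2 ^ Suc n) k = {}}" for H U n
  \<comment> \<open>The empty set is a default where the bound fails; hence capture is only eventual
    here.\<close>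
  define S where "S = (\<lambda>(H, U) n. if finite (J H U n) \<and> card (J H U n) \<le> b n then J H U n else {})"
  show ?thesis
  proof (rule that[of "S ` (\<H> \<times> B)" b])
    have "|B| \<le>o |\<H>|"
      using B(1) infinite_cofinal_null_family[OF \<H>(1)]
      by (rule countable_ordLeq_infinite)
    then have "|\<H> \<times> B| \<le>o |\<H>|"
      by (rule Times_ordLeq_infinite[OF infinite_cofinal_null_family[OF \<H>(1)] card_of_mono1[OF order_refl]])
    then show "|S ` (\<H> \<times> B)| \<le>o cof_null"
      unfolding \<H>(2) using card_of_image ordLeq_transitive by blast
    show "finite (R n) \<and> card (R n) \<le> b n" if "R \<in> S ` (\<H> \<times> B)" for R n
      using that by (auto simp: S_def)
    fix f :: "nat \<Rightarrow> nat"
    obtain H where H: "H \<in> \<H>" "digit_limsup f \<subseteq> H"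
      using \<H>(1) digit_limsup_null unfolding cofinal_null_family_def by blast
    define G where "G m = C H \<inter> (\<Union>n\<in>{m..}. digit_zero (2 ^ Suc n) (f n))" for m
    have "\<Inter>(range G) = {}"
    proof (rule ccontr)
      assume "\<Inter>(range G) \<noteq> {}"
      then obtain x where x: "\<And>m. x \<in> G m" by auto
      have "x \<in> C H" using x[of 0] by (simp add: G_def)
      moreover have "x \<in> digit_limsup f"
      proof -
        have "x \<in> {0..<1}" using x[of 0] C(3)[OF H(1)] by (auto simp: G_def)
        moreover have "\<exists>n\<ge>m. x \<in> digit_zero (2 ^ Suc n) (f n)" for m using x[of m] by (auto simp: G_def)
        ultimately show ?thesis unfolding digit_limsup_def limsup_INF_SUP by auto
      qed
      ultimately show False using H C(3) by blast
    qed
    \<comment> \<open>If all the relatively open sets \<open>G m\<close> were dense in the closed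
      set, Baire's theorem would make their empty intersection dense.\<close>
    then have "\<not> C H \<subseteq> closure (\<Inter>(range G))" using C(2)[OF H(1)] by simp
    moreover have "openin (top_of_set (C H)) (G m)" for m
      unfolding G_def by (intro openin_open_Int open_UN ballI open_digit_zero)
    ultimately obtain m where "\<not> C H \<subseteq> closure (G m)"
      using Baire[OF C(1)[OF H(1)], of "range G"] by auto
    then obtain x where x: "x \<in> C H" "x \<notin> closure (G m)" by blast
    obtain U where U: "U \<in> B" "x \<in> U" "U \<subseteq> - closure (G m)"
      using topological_basisE[OF B(2), of "- closure (G m)" x] x by auto
    have "open U" using B U topological_basis_open by auto
    then have pos: "0 < emeasure lebesgue (C H \<inter> U)" using C(4)[OF H(1)] U x by blast
    have "U \<inter> G m = {}" using U(3) closure_subset[of "G m"] by blast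
    then have fJ: "f n \<in> J H U n" if "n \<ge> m" for n
      using that unfolding J_def G_def by auto
    obtain m' where m': "ennreal (1 / real (Suc n)) \<le> emeasure lebesgue (C H \<inter> U)" if "n \<ge> m'" for n
    proof -
      obtain e :: real where e: "0 < e" "ennreal e \<le> emeasure lebesgue (C H \<inter> U)"
        using pos by (cases "emeasure lebesgue (C H \<inter> U)" rule: ennreal_cases) (auto intro: that[of 1])
      obtain m' where m': "1 / real (Suc m') < e" using e(1) nat_approx_posE by blast
      have "ennreal (1 / real (Suc n)) \<le> emeasure lebesgue (C H \<inter> U)" if "n \<ge> m'" for n
      proof -
        have "1 / real (Suc n) \<le> 1 / real (Suc m')" using that by (simp add: frac_le)
        then have "ennreal (1 / real (Suc n)) \<le> ennreal e" using m' by (intro ennreal_leI) linarith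
        then show ?thesis using e(2) by (rule order_trans)
      qed
      then show ?thesis using that by blast
    qed
    have "f n \<in> S (H, U) n" if n: "n > max m m'" for n
    proof -
      have "C H \<inter> U \<subseteq> {0..<1}" using C(3)[OF H(1)] by auto
      then have "finite (J H U n) \<and> card (J H U n) \<le> b n"
        by (rule b) (use n m' in \<open>auto simp: J_def\<close>)
      then show ?thesis using fJ n by (simp add: S_def)
    qed
    then show "\<exists>R\<in>S ` (\<H> \<times> B). \<exists>m. \<forall>n>m. f n \<in> R n" using H(1) U(1) by blast
  qed
qed

text \<open>Two improvements on eventual capture: the bound may grow arbitrarily slowly, and every
  index is captured. Initial segments of \<open>f\<close> are coded by single naturals; a slalom
  that captures the code at index \<open>\<nu> j\<close> by \<open>b (\<nu> j)\<close> candidates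
  yields no more candidates for \<open>f j\<close>. The finitely many entries out of its reach are
  stored outright in one further natural, which costs only a countable factor.\<close>

lemma slaloms:
  fixes h :: "nat \<Rightarrow> nat"
  assumes h: "filterlim h at_top sequentially" and h1: "\<And>n. 1 \<le> h n"
  obtains \<S> :: "(nat \<Rightarrow> nat set) set" where
    "|\<S>| \<le>o cof_null" "\<And>S n. S \<in> \<S> \<Longrightarrow> finite (S n) \<and> card (S n) \<le> h n"
    "\<And>f. \<exists>S\<in>\<S>. \<forall>n. f n \<in> S n"
proof -
  obtain b \<T> where \<T>: "|\<T> :: (nat \<Rightarrow> nat set) set| \<le>o cof_null"
    "\<And>S n. S \<in> \<T> \<Longrightarrow> finite (S n) \<and> card (S n) \<le> b n"
    "\<And>f. \<exists>S\<in>\<T>. \<exists>m. \<forall>n>m. f n \<in> S n"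
    using eventual_slaloms by metis
  define A where "A j = {n. n \<le> j \<and> (n = 0 \<or> b n \<le> h j)}" for j
  \<comment> \<open>The slowed-down index: the largest \<open>n\<close> \<le> \<open>j\<close> with
    \<open>b n\<close> \<le> \<open>h j\<close>. The value 0 is a default without this bound,
    harmless since \<open>R\<close> consults \<open>S (\<nu> j)\<close> only if
    \<open>\<nu> j\<close> exceeds \<open>m\<close>.\<close>
  define \<nu> where "\<nu> j = Max (A j)" for j
  have A: "finite (A j)" "A j \<noteq> {}" for j by (auto simp: A_def)
  have \<nu>: "b (\<nu> j) \<le> h j" if "\<nu> j > 0" for j
    using Max_in[OF A[of j]] that by (auto simp: \<nu>_def A_def)
  \<comment> \<open>As \<open>h\<close> tends to infinity, so does \<open>\<nu>\<close>; thus only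
    finitely many \<open>j\<close> satisfy \<open>\<nu> j\<close> \<le> \<open>n\<close>.\<close>
  have "\<exists>g. \<forall>j. \<nu> j \<le> n \<longrightarrow> j < g" for n
  proof -
    obtain g where g: "\<And>j. j \<ge> g \<Longrightarrow> b (Suc n) \<le> h j"
      using h unfolding filterlim_at_top eventually_sequentially by meson
    have "Suc n \<le> \<nu> j" if "j \<ge> max g (Suc n)" for j
      unfolding \<nu>_def using that g A by (intro Max_ge) (auto simp: A_def)
    then show ?thesis by (intro exI[of _ "max g (Suc n)"]) (meson not_less not_less_eq_eq)
  qed
  then obtain g where g: "\<And>n j. \<nu> j \<le> n \<Longrightarrow> j < g n" by metis
  define code where "code f n = list_encode (map f [0..<g n])" for f n
  have decode: "list_decode (code f n) ! j = f j" if "\<nu> j \<le> n" for f n j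
    using g[OF that] by (simp add: code_def)
  define R where "R = (\<lambda>(S, m, c) j. if \<nu> j \<le> m then {list_decode c ! j}
     else (\<lambda>k. list_decode k ! j) ` S (\<nu> j))"
  show ?thesis
  proof (rule that[of "R ` (\<T> \<times> (UNIV :: (nat \<times> nat) set))"])
    obtain \<H> where \<H>: "cofinal_null_family \<H>" "cof_null = |\<H>|"
      using cof_null_is_minimum(1) by blast
    have "|UNIV :: (nat \<times> nat) set| \<le>o |\<H>|"
      using infinite_cofinal_null_family[OF \<H>(1)]
      by (intro countable_ordLeq_infinite) simp_all
    then have "|\<T> \<times> (UNIV :: (nat \<times> nat) set)| \<le>o |\<H>|"
      using infinite_cofinal_null_family[OF \<H>(1)] \<T>(1) \<H>(2)
      by (intro Times_ordLeq_infinite) auto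
    then show "|R ` (\<T> \<times> (UNIV :: (nat \<times> nat) set))| \<le>o cof_null"
      unfolding \<H>(2) using card_of_image ordLeq_transitive by blast
  next
    fix Q j assume "Q \<in> R ` (\<T> \<times> (UNIV :: (nat \<times> nat) set))"
    then obtain S m c where Q: "S \<in> \<T>" "Q = R (S, m, c)" by auto
    have "card ((\<lambda>k. list_decode k ! j) ` S (\<nu> j)) \<le> card (S (\<nu> j))"
      using \<T>(2)[OF Q(1), of "\<nu> j"] by (intro card_image_le) simp
    then have "card ((\<lambda>k. list_decode k ! j) ` S (\<nu> j)) \<le> h j" if "\<not> \<nu> j \<le> m"
      using \<T>(2)[OF Q(1), of "\<nu> j"] \<nu>[of j] that by linarith
    then show "finite (Q j) \<and> card (Q j) \<le> h j"
      using Q h1[of j] \<T>(2)[OF Q(1), of "\<nu> j"] by (auto simp: R_def)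
  next
    fix f :: "nat \<Rightarrow> nat"
    obtain S m where S: "S \<in> \<T>" "\<And>n. n > m \<Longrightarrow> code f n \<in> S n" using \<T>(3)[of "code f"] by auto
    have "f j \<in> R (S, m, code f m) j" for j
    proof (cases "\<nu> j \<le> m")
      case True
      then show ?thesis by (simp add: R_def decode)
    next
      case False
      then have "code f (\<nu> j) \<in> S (\<nu> j)" using S by simp
      then show ?thesis using False decode[of j "\<nu> j" f] by (force simp: R_def image_iff)
    qed
    then show "\<exists>Q\<in>R ` (\<T> \<times> (UNIV :: (nat \<times> nat) set)). \<forall>j. f j \<in> Q j" using S(1) by blast
  qed
qed

section \<open>Locally compact groups\<close>

locale lc_group = group G for G :: "'a monoid" (structure) +
  fixes T :: "'a topology"
  assumes lcg: "locally_compact_group G T"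
begin

lemma topspace_eq [simp]: "topspace T = carrier G"
  using lcg by (auto simp: locally_compact_group_def topological_group_def)

lemma Hausdorff: "Hausdorff_space T"
  using lcg by (auto simp: locally_compact_group_def topological_group_def)

lemma continuous_mult: "continuous_map (prod_topology T T) T (\<lambda>(x, y). x \<otimes> y)"
  using lcg by (auto simp: locally_compact_group_def topological_group_def)

lemma continuous_inv: "continuous_map T T (\<lambda>x. inv x)"
  using lcg by (auto simp: locally_compact_group_def topological_group_def)

lemma openin_carrier: "openin T U \<Longrightarrow> U \<subseteq> carrier G"
  using openin_subset by fastforce

lemma compactin_carrier: "compactin T K \<Longrightarrow> K \<subseteq> carrier G"
  using compactin_subset_topspace by fastforce

lemma compactin_closedin: "compactin T K \<Longrightarrow> closedin T K"
  using Hausdorff compactin_imp_closedin by blast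

lemma openin_top: "openin T (carrier G)"
  using openin_topspace[of T] by simp

lemma continuous_lmult: "g \<in> carrier G \<Longrightarrow> continuous_map T T (\<lambda>x. g \<otimes> x)"
  using continuous_map_compose[OF _ continuous_mult, of T "\<lambda>x. (g, x)"]
  by (simp add: o_def continuous_map_paired)

lemma continuous_rmult: "g \<in> carrier G \<Longrightarrow> continuous_map T T (\<lambda>x. x \<otimes> g)"
  using continuous_map_compose[OF _ continuous_mult, of T "\<lambda>x. (x, g)"]
  by (simp add: o_def continuous_map_paired)

lemma mem_lcos:
  assumes "g \<in> carrier G" "A \<subseteq> carrier G"
  shows "x \<in> g <# A \<longleftrightarrow> x \<in> carrier G \<and> inv g \<otimes> x \<in> A"
proof
  assume "x \<in> g <# A"
  then obtain a where a: "a \<in> A" "x = g \<otimes> a" by (auto simp: l_coset_def)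
  moreover have "inv g \<otimes> (g \<otimes> a) = a" using assms a by (simp add: m_assoc[symmetric] subsetD)
  ultimately show "x \<in> carrier G \<and> inv g \<otimes> x \<in> A" using assms by auto
next
  assume x: "x \<in> carrier G \<and> inv g \<otimes> x \<in> A"
  then have "g \<otimes> (inv g \<otimes> x) = x" using assms by (simp add: m_assoc[symmetric])
  then show "x \<in> g <# A" using x by (force simp: l_coset_def)
qed

lemma lcos_image: "g <# A = (\<lambda>x. g \<otimes> x) ` A"
  by (auto simp: l_coset_def)

lemma lcos_Un: "g <# (A \<union> B) = (g <# A) \<union> (g <# B)"
  by (auto simp: l_coset_def)

lemma lcos_subset: "A \<subseteq> B \<Longrightarrow> g <# A \<subseteq> g <# B"
  by (auto simp: l_coset_def)

lemma openin_lcos: assumes "openin T U" "g \<in> carrier G" shows "openin T (g <# U)"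
proof -
  have "g <# U = {x \<in> topspace T. inv g \<otimes> x \<in> U}"
    using mem_lcos[OF assms(2) openin_carrier[OF assms(1)]] by auto
  then show ?thesis
    using openin_continuous_map_preimage[OF continuous_lmult[of "inv g"] assms(1)] assms by simp
qed

lemma compactin_lcos: "compactin T K \<Longrightarrow> g \<in> carrier G \<Longrightarrow> compactin T (g <# K)"
  unfolding lcos_image by (rule image_compactin[OF _ continuous_lmult])

lemma openin_rcos: assumes "openin T U" "g \<in> carrier G" shows "openin T (U #> g)"
proof -
  have U: "U \<subseteq> carrier G" using assms openin_carrier by blast
  have "U #> g = {x \<in> topspace T. x \<otimes> inv g \<in> U}"
    using U assms by (auto simp: r_coset_def m_assoc subsetD)
  then show ?thesis
    using openin_continuous_map_preimage[OF continuous_rmult[of "inv g"] assms(1)] assms by simp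
qed

lemma openin_set_mult_left: assumes "openin T U" "A \<subseteq> carrier G" shows "openin T (U <#> A)"
proof -
  have "U <#> A = (\<Union>a\<in>A. U #> a)" by (auto simp: set_mult_def r_coset_def)
  then show ?thesis using openin_rcos assms by (auto intro!: openin_Union)
qed

lemma compactin_set_mult: assumes "compactin T K" "compactin T L" shows "compactin T (K <#> L)"
proof -
  have "K <#> L = (\<lambda>(x, y). x \<otimes> y) ` (K \<times> L)" by (auto simp: set_mult_def)
  then show ?thesis
    using image_compactin[OF _ continuous_mult] assms by (simp add: compactin_Times)
qed

lemma nbhd_split:
  assumes "openin T U" "\<one> \<in> U"
  obtains V where "openin T V" "\<one> \<in> V" "\<And>x. x \<in> V \<Longrightarrow> inv x \<in> V"
    "\<And>x y. x \<in> V \<Longrightarrow> y \<in> V \<Longrightarrow> x \<otimes> y \<in> U"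
proof -
  let ?W = "{p \<in> topspace (prod_topology T T). (\<lambda>(x, y). x \<otimes> y) p \<in> U}"
  have "openin (prod_topology T T) ?W"
    by (rule openin_continuous_map_preimage[OF continuous_mult assms(1)])
  moreover have "(\<one>, \<one>) \<in> ?W" using assms by simp
  ultimately obtain A B where AB: "openin T A" "openin T B" "\<one> \<in> A" "\<one> \<in> B" "A \<times> B \<subseteq> ?W"
    unfolding openin_prod_topology_alt by meson
  let ?C = "A \<inter> B" let ?V = "?C \<inter> {x \<in> topspace T. inv x \<in> ?C}"
  show ?thesis
  proof (rule that)
    show "openin T ?V"
      using AB openin_continuous_map_preimage[OF continuous_inv] by blast
    show "\<one> \<in> ?V" using AB by simp
    show "inv x \<in> ?V" if "x \<in> ?V" for x using that by simp
    show "x \<otimes> y \<in> U" if "x \<in> ?V" "y \<in> ?V" for x y using that AB(5) by auto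
  qed
qed

text \<open>The tube lemma in Wallace's form, for the product of the compact sets
  \<open>{\<one>}\<close> and \<open>K\<close> inside the preimage of \<open>U\<close> under
  multiplication.\<close>

lemma nbhd_compact_left:
  assumes "compactin T K" "openin T U" "K \<subseteq> U"
  obtains V where "openin T V" "\<one> \<in> V" "V <#> K \<subseteq> U"
proof -
  let ?W = "{p \<in> topspace (prod_topology T T). (\<lambda>(x, y). x \<otimes> y) p \<in> U}"
  have K: "K \<subseteq> carrier G" using assms compactin_carrier by blast
  have "openin (prod_topology T T) ?W"
    by (rule openin_continuous_map_preimage[OF continuous_mult assms(2)])
  moreover have "{\<one>} \<times> K \<subseteq> ?W" using assms K by (auto simp: subset_iff)
  ultimately obtain A B where AB: "openin T A" "openin T B" "{\<one>} \<subseteq> A" "K \<subseteq> B" "A \<times> B \<subseteq> ?W"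
    by (rule Wallace_theorem_prod_topology[rotated 2]) (use assms in auto)
  have "A <#> K \<subseteq> U" using AB by (force simp: set_mult_def)
  then show ?thesis using that AB by blast
qed

lemma nbhd_compact_right:
  assumes "compactin T K" "openin T U" "K \<subseteq> U"
  obtains V where "openin T V" "\<one> \<in> V" "K <#> V \<subseteq> U"
proof -
  let ?W = "{p \<in> topspace (prod_topology T T). (\<lambda>(x, y). x \<otimes> y) p \<in> U}"
  have K: "K \<subseteq> carrier G" using assms compactin_carrier by blast
  have "openin (prod_topology T T) ?W"
    by (rule openin_continuous_map_preimage[OF continuous_mult assms(2)])
  moreover have "K \<times> {\<one>} \<subseteq> ?W" using assms K by (auto simp: subset_iff)
  ultimately obtain A B where AB: "openin T A" "openin T B" "{\<one>} \<subseteq> B" "K \<subseteq> A" "A \<times> B \<subseteq> ?W"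
    by (rule Wallace_theorem_prod_topology[rotated 2]) (use assms in auto)
  have "K <#> B \<subseteq> U" using AB by (force simp: set_mult_def)
  then show ?thesis using that AB by blast
qed

lemma compact_nbhd:
  assumes "openin T U" "x \<in> U"
  obtains V W where "openin T V" "compactin T W" "x \<in> V" "V \<subseteq> W" "W \<subseteq> U"
proof -
  have "neighbourhood_base_of (compactin T) T"
    using lcg Hausdorff locally_compact_space_neighbourhood_base
    by (auto simp: locally_compact_group_def)
  then show ?thesis using assms that unfolding neighbourhood_base_of by meson
qed

lemma compact_separation:
  assumes "compactin T K" "compactin T L" "K \<inter> L = {}"
  obtains U V where "openin T U" "openin T V" "K \<subseteq> U" "L \<subseteq> V" "U \<inter> V = {}"
proof -
  have "disjnt K L" using assms(3) by (simp add: disjnt_def)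
  then obtain U V where "openin T U" "openin T V" "K \<subseteq> U" "L \<subseteq> V" "disjnt U V"
    using Hausdorff_space_compact_separation[OF Hausdorff assms(1,2)] by blast
  then show ?thesis using that by (auto simp: disjnt_def)
qed

text \<open>Multiplying \<open>K\<close> by a small compact neighbourhood of the identity thickens
  it without leaving \<open>U\<close>. This serves to bound the measure of \<open>K\<close> by the
  content of a larger compact set.\<close>

lemma compact_superset:
  assumes "compactin T K" "openin T U" "K \<subseteq> U"
  obtains V W where "openin T V" "compactin T W" "K \<subseteq> V" "V \<subseteq> W" "W \<subseteq> U"
proof -
  obtain N where N: "openin T N" "\<one> \<in> N" "N <#> K \<subseteq> U"
    using nbhd_compact_left assms by blast
  obtain V W where VW: "openin T V" "compactin T W" "\<one> \<in> V" "V \<subseteq> W" "W \<subseteq> N"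
    using compact_nbhd N by blast
  have K: "K \<subseteq> carrier G" using assms compactin_carrier by blast
  show ?thesis
  proof (rule that)
    show "openin T (V <#> K)" using VW K openin_set_mult_left by blast
    show "compactin T (W <#> K)" using VW assms compactin_set_mult by blast
    show "K \<subseteq> V <#> K" using VW K by (force simp: set_mult_def)
    show "V <#> K \<subseteq> W <#> K" using VW by (auto simp: set_mult_def)
    show "W <#> K \<subseteq> U" using VW N by (fastforce simp: set_mult_def)
  qed
qed

lemma nested_compact_nonempty:
  fixes Z :: "nat \<Rightarrow> 'a set"
  assumes "\<And>n. compactin T (Z n)" "\<And>n. Z n \<noteq> {}" "\<And>n. Z (Suc n) \<subseteq> Z n"
  obtains a where "\<And>n. a \<in> Z n"
proof -
  have dec: "decseq Z" using assms(3) by (simp add: decseq_Suc_iff)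
  have "compact_space (subtopology T (Z 0))" using assms(1) by (simp add: compactin_subspace)
  moreover have "closedin (subtopology T (Z 0)) (Z n)" for n
    using compactin_closedin[OF assms(1)] decseqD[OF dec, of 0 n] by (simp add: closedin_subset_topspace)
  ultimately have "(\<Inter>n. Z n) \<noteq> {}"
    using assms(2) dec by (rule compact_space_imp_nest)
  then show ?thesis using that by blast
qed

lemma openin_finite_Inter:
  assumes "finite I" "\<And>i. i \<in> I \<Longrightarrow> openin T (U i)"
  shows "openin T (carrier G \<inter> (\<Inter>i\<in>I. U i))"
  using openin_INT[OF assms] by (simp add: Int_commute)

lemma compactin_diff: assumes "compactin T K" "openin T U" shows "compactin T (K - U)"
proof -
  have "closedin T (topspace T - U)" using assms by blast
  then have "compactin T ((topspace T - U) \<inter> K)"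
    using assms closed_Int_compactin by blast
  moreover have "(topspace T - U) \<inter> K = K - U"
    using compactin_carrier[OF assms(1)] by auto
  ultimately show ?thesis by simp
qed

end

section \<open>Haar measure\<close>

no_notation subset_mset (infix \<open><#\<close> 50)

context lc_group
begin

text \<open>Haar's index (K : V). The minimum is taken over a nonempty set when \<open>K\<close> is
  compact and \<open>V\<close> is open and nonempty, the case in which it is used.\<close>

definition cov :: "'a set \<Rightarrow> 'a set \<Rightarrow> nat" where
  "cov K V = (LEAST n. \<exists>F. finite F \<and> F \<subseteq> carrier G \<and> card F = n \<and> K \<subseteq> F <#> V)"

lemma set_mult_mono: "A \<subseteq> A' \<Longrightarrow> B \<subseteq> B' \<Longrightarrow> A <#> B \<subseteq> A' <#> B'"
  by (fastforce simp: set_mult_def)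

lemma mult_inv_cancel:
  assumes "a \<in> carrier G" "b \<in> carrier G"
  shows "a \<otimes> (inv a \<otimes> b) = b" "inv a \<otimes> (a \<otimes> b) = b"
  using assms by (simp_all add: m_assoc[symmetric])

lemma finite_cover:
  assumes "compactin T K" "openin T V" "V \<noteq> {}"
  obtains F where "finite F" "F \<subseteq> carrier G" "K \<subseteq> F <#> V"
proof -
  obtain v where v: "v \<in> V" using assms by auto
  have vc: "v \<in> carrier G" using v assms openin_carrier by blast
  let ?U = "(\<lambda>x. (x \<otimes> inv v) <# V) ` K"
  have K: "K \<subseteq> carrier G" using assms compactin_carrier by blast
  have "\<And>U. U \<in> ?U \<Longrightarrow> openin T U" using K vc assms openin_lcos by (auto simp: subset_iff)
  moreover have "K \<subseteq> \<Union>?U"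
  proof
    fix x assume x: "x \<in> K"
    then have "x = (x \<otimes> inv v) \<otimes> v" using K vc by (simp add: m_assoc subsetD)
    then have "x \<in> (x \<otimes> inv v) <# V" using v unfolding l_coset_def by blast
    then show "x \<in> \<Union>?U" using x by blast
  qed
  ultimately obtain \<F> where \<F>: "finite \<F>" "\<F> \<subseteq> ?U" "K \<subseteq> \<Union>\<F>"
    using assms(1) unfolding compactin_def by meson
  then obtain F where F: "finite F" "F \<subseteq> K" "\<F> = (\<lambda>x. (x \<otimes> inv v) <# V) ` F"
    by (metis finite_subset_image)
  show ?thesis
  proof (rule that)
    show "finite ((\<lambda>x. x \<otimes> inv v) ` F)" "(\<lambda>x. x \<otimes> inv v) ` F \<subseteq> carrier G"
      using F K vc by auto
    show "K \<subseteq> (\<lambda>x. x \<otimes> inv v) ` F <#> V"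
      using \<F> F by (auto simp: set_mult_def l_coset_def)
  qed
qed

lemma cov_witness:
  assumes "compactin T K" "openin T V" "V \<noteq> {}"
  obtains F where "finite F" "F \<subseteq> carrier G" "card F = cov K V" "K \<subseteq> F <#> V"
proof -
  have "\<exists>n F. finite F \<and> F \<subseteq> carrier G \<and> card F = n \<and> K \<subseteq> F <#> V"
    using finite_cover[OF assms] by metis
  then have "\<exists>F. finite F \<and> F \<subseteq> carrier G \<and> card F = cov K V \<and> K \<subseteq> F <#> V"
    unfolding cov_def by (rule LeastI_ex)
  then show ?thesis using that by blast
qed

lemma cov_le:
  assumes "finite F" "F \<subseteq> carrier G" "K \<subseteq> F <#> V"
  shows "cov K V \<le> card F"
  unfolding cov_def by (rule Least_le) (use assms in blast)

lemma cov_mono: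
  assumes "compactin T L" "openin T V" "V \<noteq> {}" "K \<subseteq> L"
  shows "cov K V \<le> cov L V"
proof -
  obtain F where "finite F" "F \<subseteq> carrier G" "card F = cov L V" "L \<subseteq> F <#> V"
    using cov_witness assms by metis
  then show ?thesis using cov_le[of F K V] assms by auto
qed

lemma cov_Un:
  assumes "compactin T K" "compactin T L" "openin T V" "V \<noteq> {}"
  shows "cov (K \<union> L) V \<le> cov K V + cov L V"
proof -
  obtain F where F: "finite F" "F \<subseteq> carrier G" "card F = cov K V" "K \<subseteq> F <#> V"
    using cov_witness assms by metis
  obtain F' where F': "finite F'" "F' \<subseteq> carrier G" "card F' = cov L V" "L \<subseteq> F' <#> V"
    using cov_witness assms by metis
  have "F <#> V \<subseteq> (F \<union> F') <#> V" "F' <#> V \<subseteq> (F \<union> F') <#> V"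
    by (intro set_mult_mono; simp)+
  then have "K \<union> L \<subseteq> (F \<union> F') <#> V" using F(4) F'(4) by blast
  then have "cov (K \<union> L) V \<le> card (F \<union> F')" using cov_le F F' by simp
  also have "\<dots> \<le> card F + card F'" by (rule card_Un_le)
  finally show ?thesis using F F' by simp
qed

lemma cov_lcos_le:
  assumes "compactin T K" "openin T V" "V \<noteq> {}" "g \<in> carrier G"
  shows "cov (g <# K) V \<le> cov K V"
proof -
  obtain F where F: "finite F" "F \<subseteq> carrier G" "card F = cov K V" "K \<subseteq> F <#> V"
    using cov_witness assms by metis
  have V: "V \<subseteq> carrier G" using assms openin_carrier by blast
  have "g <# K \<subseteq> (g <# F) <#> V"
  proof
    fix x assume "x \<in> g <# K"
    then obtain f v where "f \<in> F" "v \<in> V" "x = g \<otimes> (f \<otimes> v)"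
      using F(4) unfolding l_coset_def set_mult_def by blast
    moreover have "g \<otimes> (f \<otimes> v) = (g \<otimes> f) \<otimes> v"
      using F(2) V calculation assms(4) by (simp add: m_assoc subsetD)
    ultimately show "x \<in> (g <# F) <#> V" unfolding l_coset_def set_mult_def by blast
  qed
  moreover have "g <# F \<subseteq> carrier G" using F assms l_coset_subset_G by blast
  ultimately have "cov (g <# K) V \<le> card (g <# F)" using cov_le F by (simp add: lcos_image)
  also have "\<dots> \<le> card F" unfolding lcos_image by (rule card_image_le[OF F(1)])
  finally show ?thesis using F(3) by simp
qed

lemma cov_lcos:
  assumes "compactin T K" "openin T V" "V \<noteq> {}" "g \<in> carrier G"
  shows "cov (g <# K) V = cov K V"
proof -
  have "K \<subseteq> carrier G" using assms compactin_carrier by blast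
  then have "inv g <# (g <# K) = K" using assms(4) by (simp add: lcos_m_assoc lcos_mult_one)
  then show ?thesis
    using cov_lcos_le[OF assms] cov_lcos_le[OF compactin_lcos[OF assms(1,4)] assms(2,3), of "inv g"]
      assms(4) by simp
qed

text \<open>Cover \<open>K\<close> by translates of \<open>U\<close>, and each of these by
  translates of \<open>V\<close>. After division by (A : V) this bounds the normalised indices
  uniformly in \<open>V\<close>.\<close>

lemma cov_mult_le:
  assumes "compactin T K" "openin T U" "U \<noteq> {}" "U \<subseteq> A" "compactin T A" "openin T V" "V \<noteq> {}"
  shows "cov K V \<le> cov K U * cov A V"
proof -
  obtain F where F: "finite F" "F \<subseteq> carrier G" "card F = cov K U" "K \<subseteq> F <#> U"
    using cov_witness assms by metis
  obtain E where E: "finite E" "E \<subseteq> carrier G" "card E = cov A V" "A \<subseteq> E <#> V"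
    using cov_witness assms by metis
  have V: "V \<subseteq> carrier G" using assms openin_carrier by blast
  have "U \<subseteq> E <#> V" using E(4) assms(4) by blast
  then have "K \<subseteq> F <#> (E <#> V)" using F(4) by (meson order_refl order_trans set_mult_mono)
  also have "\<dots> = (F <#> E) <#> V" using set_mult_assoc F E V by metis
  finally have 1: "K \<subseteq> (F <#> E) <#> V" .
  have 2: "F <#> E = (\<lambda>(x, y). x \<otimes> y) ` (F \<times> E)" by (auto simp: set_mult_def)
  have "F <#> E \<subseteq> carrier G" using F E set_mult_closed by blast
  then have "cov K V \<le> card (F <#> E)" using cov_le[OF _ _ 1] 2 F E by simp
  also have "\<dots> \<le> card (F \<times> E)" unfolding 2 by (rule card_image_le) (use F E in simp)
  finally show ?thesis using F E by (simp add: card_cartesian_product)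
qed

lemma cov_pos:
  assumes "compactin T K" "openin T V" "V \<noteq> {}" "K \<noteq> {}"
  shows "cov K V > 0"
proof (rule ccontr)
  assume "\<not> cov K V > 0"
  moreover obtain F where "finite F" "F \<subseteq> carrier G" "card F = cov K V" "K \<subseteq> F <#> V"
    using cov_witness assms by metis
  ultimately show False using assms by (simp add: set_mult_def)
qed

text \<open>Once the quotients \<open>inv u \<otimes> u'\<close> of points of \<open>U\<close> are
  too small to lead from \<open>K\<close> to \<open>L\<close>, no left translate of a
  \<open>V\<close> inside \<open>U\<close> meets both. A minimal cover of the union then splits in
  two.\<close>

lemma cov_disjoint:
  assumes "compactin T K" "compactin T L" "K \<inter> L = {}"
  obtains U where "openin T U" "\<one> \<in> U"
    "\<And>V. openin T V \<Longrightarrow> V \<noteq> {} \<Longrightarrow> V \<subseteq> U \<Longrightarrow> cov (K \<union> L) V = cov K V + cov L V"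
proof -
  have Kc: "K \<subseteq> carrier G" and Lc: "L \<subseteq> carrier G" using assms compactin_carrier by blast+
  have "openin T (carrier G - L)"
    using openin_diff[OF openin_top compactin_closedin[OF assms(2)]] .
  then obtain N where N: "openin T N" "\<one> \<in> N" "K <#> N \<subseteq> carrier G - L"
  proof (rule nbhd_compact_right[OF assms(1)])
    show "K \<subseteq> carrier G - L" using assms(3) Kc by blast
  qed
  obtain U where U: "openin T U" "\<one> \<in> U" "\<And>x. x \<in> U \<Longrightarrow> inv x \<in> U"
    "\<And>x y. x \<in> U \<Longrightarrow> y \<in> U \<Longrightarrow> x \<otimes> y \<in> N" using nbhd_split N by blast
  have Uc: "U \<subseteq> carrier G" using U openin_carrier by blast
  have key: "\<not> (g \<otimes> u \<in> K \<and> g \<otimes> u' \<in> L)" if "g \<in> carrier G" "u \<in> U" "u' \<in> U" for g u u'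
  proof
    assume *: "g \<otimes> u \<in> K \<and> g \<otimes> u' \<in> L"
    have c: "u \<in> carrier G" "u' \<in> carrier G" using that Uc by auto
    have "(g \<otimes> u) \<otimes> (inv u \<otimes> u') = g \<otimes> u'"
      using that(1) c by (simp add: m_assoc mult_inv_cancel)
    moreover have "inv u \<otimes> u' \<in> N" using U that by blast
    ultimately have "g \<otimes> u' \<in> K <#> N" using * unfolding set_mult_def by blast
    then show False using N(3) * by blast
  qed
  show ?thesis
  proof (rule that[OF U(1,2)])
    fix V assume V: "openin T V" "V \<noteq> {}" "V \<subseteq> U"
    have KL: "compactin T (K \<union> L)" using assms compactin_Un by blast
    obtain F where F: "finite F" "F \<subseteq> carrier G" "card F = cov (K \<union> L) V" "K \<union> L \<subseteq> F <#> V"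
      using cov_witness[OF KL V(1,2)] by metis
    let ?A = "{g \<in> F. \<exists>v\<in>V. g \<otimes> v \<in> K}" and ?B = "{g \<in> F. \<exists>v\<in>V. g \<otimes> v \<in> L}"
    have "K \<subseteq> ?A <#> V" "L \<subseteq> ?B <#> V" using F(4) unfolding set_mult_def by blast+
    then have "cov K V \<le> card ?A" "cov L V \<le> card ?B"
      using F by (auto intro!: cov_le)
    moreover have "?A \<inter> ?B = {}" using key V F by blast
    then have "card ?A + card ?B = card (?A \<union> ?B)" using F by (simp add: card_Un_disjoint)
    moreover have "card (?A \<union> ?B) \<le> card F" using F by (intro card_mono) auto
    ultimately have "cov K V + cov L V \<le> cov (K \<union> L) V" using F by simp
    then show "cov (K \<union> L) V = cov K V + cov L V" using cov_Un assms V by (simp add: le_antisym)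
  qed
qed

definition haar_content :: "('a set \<Rightarrow> real) \<Rightarrow> bool" where
  "haar_content \<phi> \<longleftrightarrow>
     (\<forall>K. \<phi> K \<ge> 0) \<and>
     (\<forall>K L. compactin T L \<longrightarrow> K \<subseteq> L \<longrightarrow> compactin T K \<longrightarrow> \<phi> K \<le> \<phi> L) \<and>
     (\<forall>K L. compactin T K \<longrightarrow> compactin T L \<longrightarrow> \<phi> (K \<union> L) \<le> \<phi> K + \<phi> L) \<and>
     (\<forall>K L. compactin T K \<longrightarrow> compactin T L \<longrightarrow> K \<inter> L = {} \<longrightarrow> \<phi> (K \<union> L) = \<phi> K + \<phi> L) \<and>
     (\<forall>K g. compactin T K \<longrightarrow> g \<in> carrier G \<longrightarrow> \<phi> (g <# K) = \<phi> K) \<and>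
     (\<exists>A. compactin T A \<and> \<phi> A > 0)"

text \<open>The normalised covering numbers form a net in a compact product of intervals; a cluster
  point along shrinking neighbourhoods of the identity inherits every closed condition which
  eventually holds along the net.\<close>

lemma haar_content_exists: "\<exists>\<phi>. haar_content \<phi>"
proof -
  obtain U0 A where A: "openin T U0" "compactin T A" "\<one> \<in> U0" "U0 \<subseteq> A"
    using compact_nbhd[OF openin_top one_closed] by metis
  have U0: "U0 \<noteq> {}" "A \<noteq> {}" using A by auto
  define b where "b K = (if compactin T K then real (cov K U0) else 0)" for K
  define \<Lambda> where "\<Lambda> V K = (if compactin T K then real (cov K V) / real (cov A V) else 0)" for V K
  define nb where "nb = {V. openin T V \<and> \<one> \<in> V}"
  define S where "S = PiE UNIV (\<lambda>K. {0..b K})"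
  define \<C> where "\<C> U = closure (\<Lambda> ` {V \<in> nb. V \<subseteq> U})" for U
  have nbD: "openin T V" "V \<noteq> {}" if "V \<in> nb" for V using that by (auto simp: nb_def)
  have covA: "cov A V > 0" if "V \<in> nb" for V using cov_pos A nbD[OF that] U0 by blast
  have \<Lambda>S: "\<Lambda> V \<in> S" if V: "V \<in> nb" for V
  proof -
    have "cov K V \<le> cov K U0 * cov A V" if "compactin T K" for K
      using cov_mult_le[OF that A(1) U0(1) A(4,2) nbD[OF V]] .
    then have "real (cov K V) \<le> real (cov K U0) * real (cov A V)" if "compactin T K" for K
      using that by (metis of_nat_le_iff of_nat_mult)
    then show ?thesis using covA[OF V] by (auto simp: S_def \<Lambda>_def b_def divide_simps)
  qed
  have "compactin (product_topology (\<lambda>i. euclidean) UNIV) S"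
    unfolding S_def by (subst compactin_PiE) auto
  then have cS: "compact S" by (simp add: euclidean_product_topology)
  have "S \<inter> \<Inter>(\<C> ` nb) \<noteq> {}"
  proof (rule compact_imp_fip[OF cS])
    show "closed t" if "t \<in> \<C> ` nb" for t using that by (auto simp: \<C>_def)
    fix F' assume F': "finite F'" "F' \<subseteq> \<C> ` nb"
    then obtain N where N: "finite N" "N \<subseteq> nb" "F' = \<C> ` N" by (metis finite_subset_image)
    define V where "V = carrier G \<inter> \<Inter>N"
    have "openin T V"
    proof (cases "N = {}")
      case False
      then have "openin T (\<Inter>N)" using N by (auto intro!: openin_Inter simp: nb_def)
      then show ?thesis using openin_top by (auto simp: V_def)
    qed (simp add: V_def openin_top)
    then have V: "V \<in> nb" using N by (auto simp: nb_def V_def)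
    have "\<Lambda> V \<in> \<C> U" if "U \<in> N" for U
      unfolding \<C>_def by (rule subsetD[OF closure_subset]) (use that V in \<open>auto simp: V_def\<close>)
    then show "S \<inter> \<Inter>F' \<noteq> {}" using \<Lambda>S[OF V] N by auto
  qed
  then obtain \<phi> where \<phi>: "\<phi> \<in> S" "\<And>U. U \<in> nb \<Longrightarrow> \<phi> \<in> \<C> U" by auto
  have top_nb: "carrier G \<in> nb" by (simp add: nb_def openin_top)
  have lim: "P \<phi>" if "closed {\<psi>. P \<psi>}" "U \<in> nb" "\<And>V. V \<in> nb \<Longrightarrow> V \<subseteq> U \<Longrightarrow> P (\<Lambda> V)" for P U
  proof -
    have "\<C> U \<subseteq> {\<psi>. P \<psi>}" unfolding \<C>_def by (rule closure_minimal) (use that in auto)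
    then show ?thesis using \<phi> that by auto
  qed
  have ev: "continuous_on UNIV (\<lambda>\<psi>::'a set \<Rightarrow> real. \<psi> K)" for K
    by (rule continuous_on_product_coordinates)
  have "haar_content \<phi>"
    unfolding haar_content_def
  proof (intro conjI allI impI)
    show "0 \<le> \<phi> K" for K using \<phi>(1) by (auto simp: S_def PiE_def Pi_def)
    fix K L assume L: "compactin T L"
    {
      assume "K \<subseteq> L" and K: "compactin T K"
      show "\<phi> K \<le> \<phi> L"
      proof (rule lim[OF _ top_nb])
        show "closed {\<psi>::'a set \<Rightarrow> real. \<psi> K \<le> \<psi> L}" by (intro closed_Collect_le ev)
        show "\<Lambda> V K \<le> \<Lambda> V L" if "V \<in> nb" for V
          using cov_mono[OF L nbD[OF that] \<open>K \<subseteq> L\<close>] K L by (simp add: \<Lambda>_def divide_right_mono)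
      qed
    }
  next
    fix K L assume K: "compactin T K" and L: "compactin T L"
    have KL: "compactin T (K \<union> L)" using K L compactin_Un by blast
    show "\<phi> (K \<union> L) \<le> \<phi> K + \<phi> L"
    proof (rule lim[OF _ top_nb])
      show "closed {\<psi>::'a set \<Rightarrow> real. \<psi> (K \<union> L) \<le> \<psi> K + \<psi> L}"
        by (intro closed_Collect_le ev continuous_intros)
      show "\<Lambda> V (K \<union> L) \<le> \<Lambda> V K + \<Lambda> V L" if "V \<in> nb" for V
      proof -
        have "real (cov (K \<union> L) V) \<le> real (cov K V) + real (cov L V)"
          using cov_Un[OF K L nbD[OF that]] by linarith
        then show ?thesis using K L KL
          by (simp add: \<Lambda>_def add_divide_distrib[symmetric] divide_right_mono)
      qed
    qed
    show "\<phi> (K \<union> L) = \<phi> K + \<phi> L" if disj: "K \<inter> L = {}"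
    proof -
      obtain U where U: "openin T U" "\<one> \<in> U"
        "\<And>V. openin T V \<Longrightarrow> V \<noteq> {} \<Longrightarrow> V \<subseteq> U \<Longrightarrow> cov (K \<union> L) V = cov K V + cov L V"
        using cov_disjoint[OF K L disj] by metis
      then have "U \<in> nb" by (simp add: nb_def)
      \<comment> \<open>Exact additivity holds only for \<open>V\<close> inside \<open>U\<close>;
        the other clauses hold for every neighbourhood \<open>V\<close>.\<close>
      then show ?thesis
      proof (rule lim[rotated])
        show "closed {\<psi>::'a set \<Rightarrow> real. \<psi> (K \<union> L) = \<psi> K + \<psi> L}"
          by (intro closed_Collect_eq ev continuous_intros)
        show "\<Lambda> V (K \<union> L) = \<Lambda> V K + \<Lambda> V L" if "V \<in> nb" "V \<subseteq> U" for V
          using U(3)[OF nbD[OF that(1)] that(2)] K L KL by (simp add: \<Lambda>_def add_divide_distrib)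
      qed
    qed
  next
    fix K g assume K: "compactin T K" and g: "g \<in> carrier G"
    show "\<phi> (g <# K) = \<phi> K"
    proof (rule lim[OF _ top_nb])
      show "closed {\<psi>::'a set \<Rightarrow> real. \<psi> (g <# K) = \<psi> K}" by (intro closed_Collect_eq ev)
      show "\<Lambda> V (g <# K) = \<Lambda> V K" if "V \<in> nb" for V
        using cov_lcos[OF K nbD[OF that] g] K compactin_lcos[OF K g] by (simp add: \<Lambda>_def)
    qed
  next
    have "\<phi> A = 1"
    proof (rule lim[OF _ top_nb])
      show "closed {\<psi>::'a set \<Rightarrow> real. \<psi> A = (1::real)}" by (intro closed_Collect_eq ev continuous_on_const)
      show "\<Lambda> V A = 1" if "V \<in> nb" for V using covA[OF that] A by (simp add: \<Lambda>_def)
    qed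
    then show "\<exists>A. compactin T A \<and> \<phi> A > 0" using A by (intro exI[of _ A]) simp
  qed
  then show ?thesis by blast
qed

abbreviation "borel_sets \<equiv> sigma_sets (carrier G) {U. openin T U}"

lemma borel_open: "openin T U \<Longrightarrow> U \<in> borel_sets"
  by (rule sigma_sets.Basic) simp

lemma borel_closed:
  assumes "closedin T C" shows "C \<in> borel_sets"
proof -
  have "carrier G - (carrier G - C) \<in> borel_sets"
    using assms by (intro sigma_sets.Compl borel_open) (metis closedin_def topspace_eq)
  moreover have "C \<subseteq> carrier G" using assms closedin_subset by fastforce
  ultimately show ?thesis by (simp add: double_diff)
qed

lemma borel_subset: "{U. openin T U} \<subseteq> Pow (carrier G)"
  using openin_carrier by auto

lemma sigma_algebra_borel: "sigma_algebra (carrier G) borel_sets"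
  by (rule sigma_algebra_sigma_sets[OF borel_subset])

lemma borel_lcos:
  assumes "B \<in> borel_sets" "g \<in> carrier G"
  shows "g <# B \<in> borel_sets"
proof -
  let ?M = "sigma (carrier G) {U. openin T U}"
  have sets: "sets ?M = borel_sets" using borel_subset by simp
  have "(\<lambda>x. inv g \<otimes> x) \<in> measurable ?M ?M"
  proof (rule measurable_measure_of[OF borel_subset])
    show "(\<lambda>x. inv g \<otimes> x) \<in> space ?M \<rightarrow> carrier G" using assms borel_subset by simp
    fix U assume U: "U \<in> {U. openin T U}"
    have "(\<lambda>x. inv g \<otimes> x) -` U \<inter> space ?M = {x \<in> topspace T. inv g \<otimes> x \<in> U}"
      using borel_subset by auto
    moreover have "openin T {x \<in> topspace T. inv g \<otimes> x \<in> U}"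
      using openin_continuous_map_preimage[OF continuous_lmult[of "inv g"]] U assms by blast
    ultimately show "(\<lambda>x. inv g \<otimes> x) -` U \<inter> space ?M \<in> sets ?M"
      using borel_open sets by metis
  qed
  then have "(\<lambda>x. inv g \<otimes> x) -` B \<inter> space ?M \<in> sets ?M"
    using assms(1) sets by (intro measurable_sets) auto
  moreover have "B \<subseteq> carrier G" using assms(1) sigma_sets_into_sp[OF borel_subset] by blast
  then have "(\<lambda>x. inv g \<otimes> x) -` B \<inter> space ?M = g <# B"
    using mem_lcos[OF assms(2)] borel_subset by auto
  ultimately show ?thesis using sets by simp
qed

text \<open>The parts of \<open>K\<close> outside \<open>U\<close> and outside \<open>V\<close> are
  disjoint compact sets; removing from \<open>K\<close> a neighbourhood of one or of the other
  leaves the two pieces. This carries subadditivity from compact to open sets.\<close>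

lemma compact_split:
  assumes "compactin T K" "openin T U" "openin T V" "K \<subseteq> U \<union> V"
  obtains K1 K2 where "compactin T K1" "compactin T K2" "K = K1 \<union> K2" "K1 \<subseteq> U" "K2 \<subseteq> V"
proof -
  have "compactin T (K - U)" "compactin T (K - V)" using assms compactin_diff by blast+
  moreover have "(K - U) \<inter> (K - V) = {}" using assms by blast
  ultimately obtain A B where AB: "openin T A" "openin T B" "K - U \<subseteq> A" "K - V \<subseteq> B" "A \<inter> B = {}"
    using compact_separation by metis
  show ?thesis
  proof (rule that)
    show "compactin T (K - A)" "compactin T (K - B)" using AB assms compactin_diff by blast+
  qed (use AB in blast)+
qed

end

section \<open>Extension of a content to a left Haar measure\<close>

locale lc_group_content = lc_group +
  fixes \<phi> :: "'a set \<Rightarrow> real"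
  assumes content: "haar_content \<phi>"
begin

lemma content_nonneg: "0 \<le> \<phi> K"
  and content_mono: "compactin T K \<Longrightarrow> compactin T L \<Longrightarrow> K \<subseteq> L \<Longrightarrow> \<phi> K \<le> \<phi> L"
  and content_Un_le: "compactin T K \<Longrightarrow> compactin T L \<Longrightarrow> \<phi> (K \<union> L) \<le> \<phi> K + \<phi> L"
  and content_Un: "compactin T K \<Longrightarrow> compactin T L \<Longrightarrow> K \<inter> L = {} \<Longrightarrow> \<phi> (K \<union> L) = \<phi> K + \<phi> L"
  and content_lcos: "compactin T K \<Longrightarrow> g \<in> carrier G \<Longrightarrow> \<phi> (g <# K) = \<phi> K"
  and content_nonzero: "\<exists>A. compactin T A \<and> \<phi> A > 0"
  using content unfolding haar_content_def by simp_all

lemma content_empty: "\<phi> {} = 0"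
  using content_Un[of "{}" "{}"] by simp

text \<open>A content need not be regular: the outer measure of a compact set may exceed
  \<open>\<phi>\<close>. The construction keeps \<open>\<phi>\<close> only through its suprema
  inside open sets.\<close>

definition open_meas :: "'a set \<Rightarrow> ennreal" where
  "open_meas U = (SUP K\<in>{K. compactin T K \<and> K \<subseteq> U}. ennreal (\<phi> K))"

definition outer_meas :: "'a set \<Rightarrow> ennreal" where
  "outer_meas B = (INF U\<in>{U. openin T U \<and> B \<subseteq> U}. open_meas U)"

lemma open_meas_ge: "compactin T K \<Longrightarrow> K \<subseteq> U \<Longrightarrow> ennreal (\<phi> K) \<le> open_meas U"
  unfolding open_meas_def by (rule SUP_upper) simp

lemma open_meas_mono: "U \<subseteq> V \<Longrightarrow> open_meas U \<le> open_meas V"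
  unfolding open_meas_def by (rule SUP_subset_mono) auto

lemma open_meas_leI: "(\<And>K. compactin T K \<Longrightarrow> K \<subseteq> U \<Longrightarrow> ennreal (\<phi> K) \<le> c) \<Longrightarrow> open_meas U \<le> c"
  unfolding open_meas_def by (rule SUP_least) simp

lemma outer_meas_le: "openin T U \<Longrightarrow> B \<subseteq> U \<Longrightarrow> outer_meas B \<le> open_meas U"
  unfolding outer_meas_def by (rule INF_lower) simp

lemma outer_meas_geI: "(\<And>U. openin T U \<Longrightarrow> B \<subseteq> U \<Longrightarrow> c \<le> open_meas U) \<Longrightarrow> c \<le> outer_meas B"
  unfolding outer_meas_def by (rule INF_greatest) simp

lemma outer_meas_mono: "A \<subseteq> B \<Longrightarrow> outer_meas A \<le> outer_meas B"
  by (rule outer_meas_geI) (auto intro: outer_meas_le)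

lemma outer_meas_open: "openin T U \<Longrightarrow> outer_meas U = open_meas U"
  by (intro antisym outer_meas_le outer_meas_geI open_meas_mono) auto

lemma content_le_outer: "compactin T K \<Longrightarrow> ennreal (\<phi> K) \<le> outer_meas K"
  by (intro outer_meas_geI open_meas_ge)

lemma open_meas_empty: "open_meas {} = 0"
proof -
  have "open_meas {} \<le> 0" by (rule open_meas_leI) (simp add: content_empty)
  then show ?thesis by simp
qed

lemma open_meas_Un:
  assumes "openin T U" "openin T V"
  shows "open_meas (U \<union> V) \<le> open_meas U + open_meas V"
proof (rule open_meas_leI)
  fix K assume "compactin T K" "K \<subseteq> U \<union> V"
  then obtain K1 K2 where K: "compactin T K1" "compactin T K2" "K = K1 \<union> K2" "K1 \<subseteq> U" "K2 \<subseteq> V"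
    using compact_split assms by metis
  have "ennreal (\<phi> K) \<le> ennreal (\<phi> K1 + \<phi> K2)"
    using K content_Un_le by (intro ennreal_leI) simp
  also have "\<dots> = ennreal (\<phi> K1) + ennreal (\<phi> K2)" by (simp add: content_nonneg)
  also have "\<dots> \<le> open_meas U + open_meas V" using K by (intro add_mono open_meas_ge)
  finally show "ennreal (\<phi> K) \<le> open_meas U + open_meas V" .
qed

lemma open_meas_UN_finite:
  assumes "\<And>i::nat. openin T (U i)"
  shows "open_meas (\<Union>i<n. U i) \<le> (\<Sum>i<n. open_meas (U i))"
proof (induction n)
  case 0
  then show ?case by (simp add: open_meas_empty)
next
  case (Suc n)
  have "open_meas (\<Union>i<Suc n. U i) = open_meas ((\<Union>i<n. U i) \<union> U n)"
    by (simp add: lessThan_Suc Un_commute)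
  also have "\<dots> \<le> open_meas (\<Union>i<n. U i) + open_meas (U n)"
    using assms by (intro open_meas_Un openin_Union) auto
  also have "\<dots> \<le> (\<Sum>i<n. open_meas (U i)) + open_meas (U n)" using Suc by (intro add_mono) auto
  finally show ?case by simp
qed

lemma open_meas_UN:
  assumes "\<And>i::nat. openin T (U i)"
  shows "open_meas (\<Union>i. U i) \<le> (\<Sum>i. open_meas (U i))"
proof (rule open_meas_leI)
  fix K assume K: "compactin T K" "K \<subseteq> (\<Union>i. U i)"
  have "\<exists>\<F>. finite \<F> \<and> \<F> \<subseteq> range U \<and> K \<subseteq> \<Union>\<F>"
    using K assms unfolding compactin_def by (metis (no_types, lifting) rangeE)
  then obtain N where "finite N" "K \<subseteq> (\<Union>i\<in>N. U i)"
    by (metis finite_subset_image)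
  moreover then obtain n where "N \<subseteq> {..<n}" using finite_nat_iff_bounded by auto
  ultimately have "K \<subseteq> (\<Union>i<n. U i)" by blast
  then have "ennreal (\<phi> K) \<le> open_meas (\<Union>i<n. U i)" using K open_meas_ge by blast
  also have "\<dots> \<le> (\<Sum>i<n. open_meas (U i))" using assms by (rule open_meas_UN_finite)
  also have "\<dots> \<le> (\<Sum>i. open_meas (U i))" by (rule sum_le_suminf) auto
  finally show "ennreal (\<phi> K) \<le> (\<Sum>i. open_meas (U i))" .
qed

lemma outer_meas_approx:
  assumes "B \<subseteq> carrier G" "0 < e"
  obtains U where "openin T U" "B \<subseteq> U" "open_meas U \<le> outer_meas B + e"
proof (cases "outer_meas B = \<infinity>")
  case True
  then show ?thesis using that[OF openin_top assms(1)] by simp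
next
  case False
  then have "outer_meas B < outer_meas B + e"
    using assms by (simp add: less_top ennreal_add_left_cancel_less)
  then obtain U where "openin T U" "B \<subseteq> U" "open_meas U < outer_meas B + e"
    unfolding outer_meas_def INF_less_iff by auto
  then show ?thesis using that by (simp add: less_imp_le)
qed

lemma outer_meas_UN:
  assumes "\<And>i::nat. A i \<subseteq> carrier G"
  shows "outer_meas (\<Union>i. A i) \<le> (\<Sum>i. outer_meas (A i))"
proof (rule ennreal_le_epsilon)
  fix e :: real assume e: "0 < e"
  define d where "d i = ennreal (e * (1/2) ^ Suc i)" for i
  have "\<forall>i. \<exists>U. openin T U \<and> A i \<subseteq> U \<and> open_meas U \<le> outer_meas (A i) + d i"
  proof
    fix i have "0 < d i" using e by (simp add: d_def)
    then show "\<exists>U. openin T U \<and> A i \<subseteq> U \<and> open_meas U \<le> outer_meas (A i) + d i"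
      using outer_meas_approx assms by metis
  qed
  then obtain U where U: "\<And>i. openin T (U i)" "\<And>i. A i \<subseteq> U i"
    "\<And>i. open_meas (U i) \<le> outer_meas (A i) + d i" by metis
  have "outer_meas (\<Union>i. A i) \<le> open_meas (\<Union>i. U i)"
    using U by (intro outer_meas_le openin_Union) auto
  also have "\<dots> \<le> (\<Sum>i. open_meas (U i))" by (rule open_meas_UN[OF U(1)])
  also have "\<dots> \<le> (\<Sum>i. outer_meas (A i) + d i)" by (intro suminf_le U(3)) auto
  also have "\<dots> = (\<Sum>i. outer_meas (A i)) + (\<Sum>i. d i)" by (simp add: suminf_add)
  also have "(\<Sum>i. d i) = ennreal e"
  proof -
    have "(\<lambda>i. e * (1/2) ^ Suc i) sums (e * 1)" by (intro sums_mult power_half_series)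
    then show ?thesis unfolding d_def using e by (intro suminf_ennreal_eq) auto
  qed
  finally show "outer_meas (\<Union>i. A i) \<le> (\<Sum>i. outer_meas (A i)) + ennreal e" .
qed

text \<open>Exhaust \<open>U \<inter> V\<close> by compact \<open>K\<close>, then
  \<open>V - K\<close> by compact \<open>L\<close>; the two are disjoint, so their contents add up
  inside \<open>V\<close>. This is Caratheodory's condition for \<open>U\<close>, tested on open
  sets.\<close>

lemma open_meas_split:
  assumes U: "openin T U" and V: "openin T V"
  shows "outer_meas (U \<inter> V) + outer_meas (V - U) \<le> open_meas V"
proof -
  have UV: "openin T (U \<inter> V)" using U V by blast
  have 1: "ennreal (\<phi> K) + outer_meas (V - U) \<le> open_meas V"
    if K: "compactin T K" "K \<subseteq> U \<inter> V" for K
  proof -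
    have "openin T (V - K)" using openin_diff[OF V compactin_closedin[OF K(1)]] .
    then have "outer_meas (V - U) \<le> open_meas (V - K)" using K by (intro outer_meas_le) auto
    then have "ennreal (\<phi> K) + outer_meas (V - U) \<le> ennreal (\<phi> K) + open_meas (V - K)"
      by (intro add_mono) auto
    also have "\<dots> = (SUP L\<in>{L. compactin T L \<and> L \<subseteq> V - K}. ennreal (\<phi> K) + ennreal (\<phi> L))"
      unfolding open_meas_def by (rule ennreal_SUP_add_right) (auto intro: exI[of _ "{}"])
    also have "\<dots> \<le> open_meas V"
    proof (rule SUP_least)
      fix L assume "L \<in> {L. compactin T L \<and> L \<subseteq> V - K}"
      then have L: "compactin T L" "L \<subseteq> V - K" by auto
      have "ennreal (\<phi> K) + ennreal (\<phi> L) = ennreal (\<phi> (K \<union> L))"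
        using content_Un[OF K(1) L(1)] L by (subst content_Un) (auto simp: content_nonneg K)
      also have "\<dots> \<le> open_meas V" using K L by (intro open_meas_ge compactin_Un) auto
      finally show "ennreal (\<phi> K) + ennreal (\<phi> L) \<le> open_meas V" .
    qed
    finally show ?thesis .
  qed
  have "outer_meas (U \<inter> V) + outer_meas (V - U)
      = (SUP K\<in>{K. compactin T K \<and> K \<subseteq> U \<inter> V}. ennreal (\<phi> K) + outer_meas (V - U))"
    unfolding outer_meas_open[OF UV] unfolding open_meas_def
    by (rule ennreal_SUP_add_left[symmetric]) (auto intro: exI[of _ "{}"])
  also have "\<dots> \<le> open_meas V" by (rule SUP_least) (use 1 in auto)
  finally show ?thesis .
qed

lemma outer_meas_split:
  assumes U: "openin T U" and B: "B \<subseteq> carrier G"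
  shows "outer_meas (U \<inter> B) + outer_meas (B - U) = outer_meas B"
proof (rule antisym)
  show "outer_meas (U \<inter> B) + outer_meas (B - U) \<le> outer_meas B"
  proof (rule outer_meas_geI)
    fix V assume V: "openin T V" "B \<subseteq> V"
    have "outer_meas (U \<inter> B) + outer_meas (B - U) \<le> outer_meas (U \<inter> V) + outer_meas (V - U)"
      using V by (intro add_mono outer_meas_mono) auto
    then show "outer_meas (U \<inter> B) + outer_meas (B - U) \<le> open_meas V"
      using open_meas_split[OF U V(1)] by (rule order_trans)
  qed
  \<comment> \<open>Subadditivity for two sets is read off the countable one, with a sequence that
    is empty from index 2 on.\<close>
  let ?A = "\<lambda>i::nat. if i = 0 then U \<inter> B else if i = 1 then B - U else {}"
  have 0: "outer_meas {} = 0" using outer_meas_open[of "{}"] open_meas_empty by simp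
  have "B = (\<Union>i. ?A i)" by (auto split: if_splits)
  moreover have "outer_meas (\<Union>i. ?A i) \<le> (\<Sum>i. outer_meas (?A i))"
    using B by (intro outer_meas_UN) auto
  ultimately have "outer_meas B \<le> (\<Sum>i. outer_meas (?A i))" by simp
  also have "\<dots> = (\<Sum>i<2. outer_meas (?A i))"
    by (rule suminf_finite) (auto simp: 0)
  finally show "outer_meas B \<le> outer_meas (U \<inter> B) + outer_meas (B - U)"
    by (simp add: numeral_2_eq_2)
qed

lemma outer_meas_lcos_le:
  assumes "g \<in> carrier G" "B \<subseteq> carrier G"
  shows "outer_meas (g <# B) \<le> outer_meas B"
proof (rule outer_meas_geI)
  fix U assume U: "openin T U" "B \<subseteq> U"
  have Uc: "U \<subseteq> carrier G" using U openin_carrier by blast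
  have "outer_meas (g <# B) \<le> open_meas (g <# U)"
    using U assms by (intro outer_meas_le openin_lcos lcos_subset)
  also have "\<dots> \<le> open_meas U"
  proof (rule open_meas_leI)
    fix K assume K: "compactin T K" "K \<subseteq> g <# U"
    have "inv g <# K \<subseteq> inv g <# (g <# U)" using K by (intro lcos_subset)
    also have "\<dots> = U" using Uc assms by (simp add: lcos_m_assoc lcos_mult_one)
    finally have "ennreal (\<phi> (inv g <# K)) \<le> open_meas U"
      using K assms by (intro open_meas_ge compactin_lcos) auto
    then show "ennreal (\<phi> K) \<le> open_meas U" using content_lcos K assms by simp
  qed
  finally show "outer_meas (g <# B) \<le> open_meas U" .
qed

lemma outer_meas_lcos:
  assumes "g \<in> carrier G" "B \<subseteq> carrier G"
  shows "outer_meas (g <# B) = outer_meas B"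
proof (rule antisym[OF outer_meas_lcos_le[OF assms]])
  have "outer_meas (inv g <# (g <# B)) \<le> outer_meas (g <# B)"
    using assms l_coset_subset_G by (intro outer_meas_lcos_le) auto
  moreover have "inv g <# (g <# B) = B" using assms by (simp add: lcos_m_assoc lcos_mult_one)
  ultimately show "outer_meas B \<le> outer_meas (g <# B)" by simp
qed

definition haar_measure :: "'a measure" where
  "haar_measure = measure_of (carrier G) {U. openin T U} outer_meas"

lemma measure_space_borel: "measure_space (carrier G) borel_sets outer_meas"
proof -
  interpret P: sigma_algebra "carrier G" "Pow (carrier G)" by (rule sigma_algebra_Pow)
  let ?L = "lambda_system (carrier G) (Pow (carrier G)) outer_meas"
  have "outer_measure_space (Pow (carrier G)) outer_meas"
    unfolding outer_measure_space_def positive_def increasing_def countably_subadditive_def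
    using outer_meas_mono outer_meas_open[of "{}"] open_meas_empty
    by (auto intro!: outer_meas_UN) blast
  then have L: "measure_space (carrier G) ?L outer_meas"
    by (rule P.caratheodory_lemma)
  have "{U. openin T U} \<subseteq> ?L"
  proof
    fix U assume "U \<in> {U. openin T U}"
    then have U: "openin T U" by simp
    have "(carrier G - U) \<inter> B = B - U" if "B \<subseteq> carrier G" for B using that by auto
    then show "U \<in> ?L"
      using outer_meas_split[OF U] openin_carrier[OF U] by (auto simp: lambda_system_def)
  qed
  then have "borel_sets \<subseteq> ?L"
    using L unfolding measure_space_def by (intro sigma_algebra.sigma_sets_subset) auto
  then show ?thesis
    using L sigma_algebra_borel unfolding measure_space_def positive_def countably_additive_def
    by (meson subset_iff subset_trans)
qed

lemma space_haar: "space haar_measure = carrier G"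
  unfolding haar_measure_def using borel_subset by simp

lemma sets_haar: "sets haar_measure = borel_sets"
  unfolding haar_measure_def using borel_subset by simp

lemma emeasure_haar: "B \<in> borel_sets \<Longrightarrow> emeasure haar_measure B = outer_meas B"
  using measure_space_borel unfolding measure_space_def
  by (intro emeasure_measure_of[OF haar_measure_def borel_subset]) (auto simp: sets_haar)

lemma left_haar_measure: "left_haar_measure G T haar_measure"
  unfolding left_haar_measure_def
proof (intro conjI allI impI ballI)
  show "space haar_measure = topspace T" by (simp add: space_haar)
  show "sets haar_measure = sigma_sets (topspace T) {U. openin T U}" by (simp add: sets_haar)
  obtain A where A: "compactin T A" "\<phi> A > 0" using content_nonzero by blast
  have "0 < ennreal (\<phi> A)" using A by simp
  also have "\<dots> \<le> outer_meas (carrier G)"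
    using open_meas_ge[OF A(1) compactin_carrier[OF A(1)]] outer_meas_open[OF openin_top] by simp
  finally show "emeasure haar_measure (space haar_measure) \<noteq> 0"
    by (simp add: space_haar emeasure_haar borel_open openin_top)
next
  fix g B assume g: "g \<in> carrier G" and B: "B \<in> sets haar_measure"
  then have "B \<subseteq> carrier G" using sets.sets_into_space space_haar by metis
  then show "emeasure haar_measure (g <# B) = emeasure haar_measure B"
    using outer_meas_lcos g B borel_lcos by (simp add: emeasure_haar sets_haar)
next
  fix K assume K: "compactin T K"
  obtain V W where VW: "openin T V" "compactin T W" "K \<subseteq> V" "V \<subseteq> W"
    using compact_superset[OF K openin_top compactin_carrier[OF K]] by metis
  have "emeasure haar_measure K = outer_meas K"
    using K by (intro emeasure_haar borel_closed compactin_closedin)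
  also have "\<dots> \<le> open_meas V" using VW by (intro outer_meas_le)
  also have "\<dots> \<le> ennreal (\<phi> W)"
    using VW content_mono by (intro open_meas_leI ennreal_leI) auto
  also have "\<dots> < \<infinity>" by simp
  finally show "emeasure haar_measure K < \<infinity>" .
next
  fix B assume B: "B \<in> sets haar_measure"
  have "emeasure haar_measure U = open_meas U" if "openin T U" for U
    using that by (simp add: emeasure_haar borel_open outer_meas_open)
  then show "emeasure haar_measure B = (INF U\<in>{U. openin T U \<and> B \<subseteq> U}. emeasure haar_measure U)"
    using B by (simp add: emeasure_haar sets_haar outer_meas_def)
next
  fix U assume U: "openin T U"
  have eU: "emeasure haar_measure U = open_meas U"
    using U by (simp add: emeasure_haar borel_open outer_meas_open)
  have eK: "emeasure haar_measure K = outer_meas K" if "compactin T K" for K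
    using that by (intro emeasure_haar borel_closed compactin_closedin)
  \<comment> \<open>\<open>\<phi> K\<close> may be smaller than the measure of \<open>K\<close>, but
    neither exceeds the measure of \<open>U\<close>, so both suprema give the same value.\<close>
  show "emeasure haar_measure U = (SUP K\<in>{K. compactin T K \<and> K \<subseteq> U}. emeasure haar_measure K)"
  proof (rule antisym)
    show "emeasure haar_measure U \<le> (SUP K\<in>{K. compactin T K \<and> K \<subseteq> U}. emeasure haar_measure K)"
      unfolding eU open_meas_def using content_le_outer eK by (intro SUP_mono) auto
    show "(SUP K\<in>{K. compactin T K \<and> K \<subseteq> U}. emeasure haar_measure K) \<le> emeasure haar_measure U"
      using eK outer_meas_le[OF U] unfolding eU by (intro SUP_least) auto
  qed
qed

end

lemma (in lc_group) left_haar_measure_exists: "\<exists>\<mu>. left_haar_measure G T \<mu>"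
proof -
  obtain \<phi> where "haar_content \<phi>" using haar_content_exists by blast
  then interpret lc_group_content G T \<phi> by unfold_locales
  show ?thesis using left_haar_measure by blast
qed

section \<open>Covering compact sets by translates of a compact null set\<close>

text \<open>The measure shrinks at stage \<open>n\<close> by a factor of at most \<open>1 - 1 / (2 (width n + 1)\<^sup>2)\<close>, hence of
  at most \<open>(n + 7) / (n + 8)\<close>; these bounds telescope.\<close>

definition width :: "nat \<Rightarrow> nat" where
  "width n = floor_sqrt ((n + 8) div 2) - 1"

text \<open>The summand 8 makes the root at least 2 already at \<open>n\<close> = 0, so the width is
  at least 1, as the slaloms require.\<close>

lemma width: "1 \<le> width n" "2 * (Suc (width n))\<^sup>2 \<le> n + 8" "filterlim width at_top sequentially"
proof -
  have 2: "2 \<le> floor_sqrt ((n + 8) div 2)" for n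
    by (subst le_floor_sqrt_iff) simp
  show "1 \<le> width n" using 2[of n] by (simp add: width_def)
  have "Suc (width n) = floor_sqrt ((n + 8) div 2)" using 2[of n] by (simp add: width_def)
  then have "(Suc (width n))\<^sup>2 \<le> (n + 8) div 2" using floor_sqrt_power2_le by metis
  then show "2 * (Suc (width n))\<^sup>2 \<le> n + 8" by linarith
  show "filterlim width at_top sequentially"
    unfolding filterlim_at_top eventually_sequentially
  proof
    fix Z
    have "Z \<le> width n" if "n \<ge> 2 * (Suc Z)\<^sup>2" for n
    proof -
      have "(Suc Z)\<^sup>2 \<le> (n + 8) div 2" using that by linarith
      then have "Suc Z \<le> floor_sqrt ((n + 8) div 2)" by (simp add: le_floor_sqrt_iff)
      then show ?thesis by (simp add: width_def)
    qed
    then show "\<exists>M. \<forall>n\<ge>M. Z \<le> width n" by blast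
  qed
qed

locale haar_group = lc_group +
  fixes \<mu> :: "'a measure"
  assumes haar: "left_haar_measure G T \<mu>"
begin

lemma sets_mu: "sets \<mu> = borel_sets"
  and emeasure_lcos: "g \<in> carrier G \<Longrightarrow> B \<in> borel_sets \<Longrightarrow> emeasure \<mu> (g <# B) = emeasure \<mu> B"
  and emeasure_compact: "compactin T K \<Longrightarrow> emeasure \<mu> K < \<infinity>"
  and outer_regular: "B \<in> borel_sets \<Longrightarrow> emeasure \<mu> B = (INF U\<in>{U. openin T U \<and> B \<subseteq> U}. emeasure \<mu> U)"
  using haar unfolding left_haar_measure_def by simp_all

lemma borel_compact: "compactin T K \<Longrightarrow> K \<in> borel_sets"
  by (intro borel_closed compactin_closedin)

lemma borel_Diff: "A \<in> borel_sets \<Longrightarrow> B \<in> borel_sets \<Longrightarrow> A - B \<in> borel_sets"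
  using sets.Diff[of A \<mu> B] sets_mu by simp

lemma borel_Un: "A \<in> borel_sets \<Longrightarrow> B \<in> borel_sets \<Longrightarrow> A \<union> B \<in> borel_sets"
  using sets.Un[of A \<mu> B] sets_mu by simp

lemma borel_Int: "A \<in> borel_sets \<Longrightarrow> B \<in> borel_sets \<Longrightarrow> A \<inter> B \<in> borel_sets"
  using sets.Int[of A \<mu> B] sets_mu by simp

lemma borel_UN: "finite I \<Longrightarrow> (\<And>i. i \<in> I \<Longrightarrow> A i \<in> borel_sets) \<Longrightarrow> (\<Union>i\<in>I. A i) \<in> borel_sets"
  using sets.finite_UN[of I A \<mu>] sets_mu by simp

lemma fmeasurable_compact: "compactin T K \<Longrightarrow> K \<in> fmeasurable \<mu>"
  using borel_compact emeasure_compact by (simp add: fmeasurable_def sets_mu)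

text \<open>The definition of a Haar measure grants inner regularity to open sets only. Inside a
  compact \<open>C\<close> it follows from outer regularity of the relative complement: subtract
  from \<open>C\<close> an open set that barely exceeds \<open>C - M\<close>.\<close>

lemma inner_compact:
  assumes C: "compactin T C" and M: "M \<in> borel_sets" "M \<subseteq> C" and e: "0 < e"
  obtains B where "compactin T B" "B \<subseteq> M" "measure \<mu> M \<le> measure \<mu> B + e"
proof -
  have Cb: "C \<in> borel_sets" by (rule borel_compact[OF C])
  have CM: "C - M \<in> borel_sets" by (rule borel_Diff[OF Cb M(1)])
  have fC: "C \<in> fmeasurable \<mu>" by (rule fmeasurable_compact[OF C])
  have fM: "M \<in> fmeasurable \<mu>" "C - M \<in> fmeasurable \<mu>"
    using fmeasurableI2[OF fC] M CM sets_mu by auto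
  have "emeasure \<mu> (C - M) < emeasure \<mu> (C - M) + ennreal e"
    using e fM(2) by (simp add: fmeasurable_def ennreal_add_left_cancel_less less_top)
  then have "(INF U\<in>{U. openin T U \<and> C - M \<subseteq> U}. emeasure \<mu> U) < emeasure \<mu> (C - M) + ennreal e"
    by (subst outer_regular[OF CM, symmetric])
  then obtain U where U: "openin T U" "C - M \<subseteq> U" "emeasure \<mu> U < emeasure \<mu> (C - M) + ennreal e"
    unfolding INF_less_iff by auto
  have fU: "U \<in> fmeasurable \<mu>"
    using U fM(2) borel_open[OF U(1)]
    by (auto simp: fmeasurable_def sets_mu intro: less_trans)
  have "ennreal (measure \<mu> U) \<le> ennreal (measure \<mu> (C - M) + e)"
    using U(3) e by (simp add: emeasure_eq_measure2[OF fU] emeasure_eq_measure2[OF fM(2)] less_imp_le)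
  then have mU: "measure \<mu> U \<le> measure \<mu> (C - M) + e"
    using e by (subst (asm) ennreal_le_iff) (auto intro: add_nonneg_nonneg)
  have cB: "compactin T (C - U)" by (rule compactin_diff[OF C U(1)])
  have "measure \<mu> C \<le> measure \<mu> ((C - U) \<union> U)"
    using fC fU fmeasurable_compact[OF cB] by (intro measure_mono_fmeasurable) (auto dest: fmeasurableD)
  also have "\<dots> \<le> measure \<mu> (C - U) + measure \<mu> U"
    using fU fmeasurable_compact[OF cB] by (intro measure_Un_le) (auto dest: fmeasurableD)
  finally have 1: "measure \<mu> C \<le> measure \<mu> (C - U) + measure \<mu> U" .
  have "measure \<mu> (C - M) = measure \<mu> C - measure \<mu> M"
    using fC fM M(2) by (intro measurable_measure_Diff) (auto dest: fmeasurableD)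
  then have "measure \<mu> M \<le> measure \<mu> (C - U) + e" using 1 mU by linarith
  then show ?thesis using that[OF cB] U(2) by blast
qed

lemma small_translates_nbhd:
  assumes "finite D" "D \<subseteq> carrier G" "\<one> \<notin> D"
  obtains W where "openin T W" "\<one> \<in> W" "\<And>d x. d \<in> D \<Longrightarrow> x \<in> W \<Longrightarrow> d \<otimes> x \<notin> W"
proof -
  have "\<exists>W. openin T W \<and> \<one> \<in> W \<and> (\<forall>x\<in>W. d \<otimes> x \<notin> W)" if d: "d \<in> D" for d
  proof -
    have dc: "d \<in> carrier G" "d \<noteq> \<one>" using d assms by auto
    then obtain U V where UV: "openin T U" "openin T V" "d \<in> U" "\<one> \<in> V" "disjnt U V"
      using Hausdorff one_closed unfolding Hausdorff_space_def topspace_eq by metis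
    let ?W = "V \<inter> {x \<in> topspace T. d \<otimes> x \<in> U}"
    have "openin T ?W" using UV openin_continuous_map_preimage[OF continuous_lmult[OF dc(1)]] by blast
    moreover have "\<one> \<in> ?W" using UV dc by simp
    moreover have "\<forall>x\<in>?W. d \<otimes> x \<notin> ?W" using UV(5) by (auto simp: disjnt_def)
    ultimately show ?thesis by blast
  qed
  then obtain W where W: "\<And>d. d \<in> D \<Longrightarrow> openin T (W d)" "\<And>d. d \<in> D \<Longrightarrow> \<one> \<in> W d"
    "\<And>d x. d \<in> D \<Longrightarrow> x \<in> W d \<Longrightarrow> d \<otimes> x \<notin> W d" by metis
  show ?thesis
    by (rule that[OF openin_finite_Inter[OF assms(1), of W]]) (use W in blast)+
qed

text \<open>A maximal set of vertices without neighbours in the graph joining \<open>x\<close> to the points \<open>d x\<close>,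
  found greedily along a finite cover by pieces that contain no edge. By maximality its translates
  cover, which bounds its measure from below.\<close>

lemma independent_set:
  assumes C: "compactin T C" and D: "finite D" "D \<subseteq> carrier G" "\<one> \<notin> D" "\<And>d. d \<in> D \<Longrightarrow> inv d \<in> D"
  obtains M where "M \<in> borel_sets" "M \<subseteq> C" "\<And>d x. d \<in> D \<Longrightarrow> x \<in> M \<Longrightarrow> d \<otimes> x \<notin> M"
    "measure \<mu> C \<le> real (Suc (card D)) * measure \<mu> M"
proof -
  have Cc: "C \<subseteq> carrier G" using C compactin_carrier by blast
  obtain W where W: "openin T W" "\<one> \<in> W" "\<And>d x. d \<in> D \<Longrightarrow> x \<in> W \<Longrightarrow> d \<otimes> x \<notin> W"
    using small_translates_nbhd[OF D(1-3)] by metis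
  have Oc: "W \<subseteq> carrier G" using W openin_carrier by blast
  \<comment> \<open>Edges are left multiplications and the pieces are right translates, so
    associativity reduces the claim to \<open>W\<close>.\<close>
  have indep: "d \<otimes> y \<notin> W #> x" if d: "d \<in> D" and y: "y \<in> W #> x" and x: "x \<in> carrier G" for d x y
  proof
    assume "d \<otimes> y \<in> W #> x"
    then obtain a b where ab: "a \<in> W" "b \<in> W" "y = a \<otimes> x" "d \<otimes> y = b \<otimes> x"
      using y by (auto simp: r_coset_def)
    have c: "a \<in> carrier G" "b \<in> carrier G" "d \<in> carrier G" using ab d D Oc by auto
    have "(d \<otimes> a) \<otimes> x = b \<otimes> x" using ab c x by (simp add: m_assoc)
    then have "d \<otimes> a = b" using c x by simp
    then show False using W(3)[OF d ab(1)] ab(2) by simp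
  qed
  \<comment> \<open>Finitely many Borel choices keep \<open>M\<close> Borel, which Zorn's lemma
    would not ensure. Maximality takes the form that \<open>M\<close> and its translates absorb all
    pieces already treated.\<close>
  have greedy: "\<exists>M. M \<in> borel_sets \<and> M \<subseteq> C \<and> (\<forall>d\<in>D. \<forall>x\<in>M. d \<otimes> x \<notin> M) \<and>
      C \<inter> (\<Union>x\<in>X. W #> x) \<subseteq> M \<union> (\<Union>d\<in>D. d <# M)" if "finite X" "X \<subseteq> carrier G" for X
    using that
  proof (induction X)
    case empty
    have "{} \<in> borel_sets" using sets.empty_sets[of \<mu>] sets_mu by simp
    then show ?case by (intro exI[of _ "{}"]) auto
  next
    case (insert x X)
    then obtain M where M: "M \<in> borel_sets" "M \<subseteq> C" "\<And>d y. d \<in> D \<Longrightarrow> y \<in> M \<Longrightarrow> d \<otimes> y \<notin> M"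
      "C \<inter> (\<Union>x\<in>X. W #> x) \<subseteq> M \<union> (\<Union>d\<in>D. d <# M)" by auto
    have x: "x \<in> carrier G" using insert by simp
    let ?I = "C \<inter> (W #> x)"
    \<comment> \<open>The points of the new piece not yet reached from \<open>M\<close>. No edge
      leads from them to \<open>M\<close> either, since \<open>D\<close> is closed under
      inverses.\<close>
    let ?N = "?I - (\<Union>d\<in>D. d <# M)"
    have "(\<Union>d\<in>D. d <# M) \<in> borel_sets" using D M borel_lcos by (intro borel_UN) auto
    then have N: "?N \<in> borel_sets"
      by (rule borel_Diff[rotated]) (intro borel_Int borel_compact[OF C] borel_open openin_rcos W(1) x)
    have "d \<otimes> y \<notin> M \<union> ?N" if d: "d \<in> D" and y: "y \<in> M \<union> ?N" for d y
    proof
      assume dy: "d \<otimes> y \<in> M \<union> ?N"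
      have dc: "d \<in> carrier G" and yc: "y \<in> carrier G" using d y D M Cc by auto
      show False
      proof (cases "y \<in> M")
        case True
        then have "d \<otimes> y \<in> (\<Union>d\<in>D. d <# M)" using d by (auto simp: l_coset_def)
        then show False using dy M(3)[OF d True] by blast
      next
        case False
        then have y: "y \<in> ?N" using y by blast
        then have "d \<otimes> y \<notin> ?N" using indep[OF d _ x] by blast
        then have "d \<otimes> y \<in> M" using dy by blast
        moreover have "y = inv d \<otimes> (d \<otimes> y)" using dc yc by (simp add: mult_inv_cancel)
        ultimately have "y \<in> inv d <# M" unfolding l_coset_def by blast
        then show False using y D(4)[OF d] by blast
      qed
    qed
    moreover have "C \<inter> (\<Union>x\<in>insert x X. W #> x) \<subseteq> (M \<union> ?N) \<union> (\<Union>d\<in>D. d <# (M \<union> ?N))"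
      using M(4) by (simp add: lcos_Un) blast
    moreover have "M \<union> ?N \<subseteq> C" using M(2) by blast
    ultimately show ?case using borel_Un[OF M(1) N] by blast
  qed
  have "\<And>U. U \<in> (\<lambda>x. W #> x) ` C \<Longrightarrow> openin T U" using openin_rcos W(1) Cc by auto
  moreover have "C \<subseteq> \<Union>((\<lambda>x. W #> x) ` C)"
  proof
    fix x assume x: "x \<in> C"
    then have "x = \<one> \<otimes> x" using Cc by auto
    then have "x \<in> W #> x" using W(2) unfolding r_coset_def by blast
    then show "x \<in> \<Union>((\<lambda>x. W #> x) ` C)" using x by blast
  qed
  ultimately obtain \<F> where \<F>: "finite \<F>" "\<F> \<subseteq> (\<lambda>x. W #> x) ` C" "C \<subseteq> \<Union>\<F>"
    using C unfolding compactin_def by meson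
  then obtain X where X: "finite X" "X \<subseteq> C" "\<F> = (\<lambda>x. W #> x) ` X" by (metis finite_subset_image)
  obtain M where M: "M \<in> borel_sets" "M \<subseteq> C" "\<And>d y. d \<in> D \<Longrightarrow> y \<in> M \<Longrightarrow> d \<otimes> y \<notin> M"
      "C \<inter> (\<Union>x\<in>X. W #> x) \<subseteq> M \<union> (\<Union>d\<in>D. d <# M)" using greedy[of X] X Cc by blast
  have fM: "M \<in> fmeasurable \<mu>"
    using fmeasurableI2[OF fmeasurable_compact[OF C] M(2)] M(1) sets_mu by simp
  have em: "emeasure \<mu> (d <# M) = emeasure \<mu> M" if "d \<in> D" for d
    using that D M emeasure_lcos by auto
  have fdM: "d <# M \<in> fmeasurable \<mu>" if "d \<in> D" for d
    using that em[OF that] fM D M(1) borel_lcos by (auto simp: fmeasurable_def sets_mu)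
  have fU: "(\<Union>d\<in>D. d <# M) \<in> fmeasurable \<mu>" using fdM D(1) by (intro fmeasurable.finite_UN) auto
  have "measure \<mu> C \<le> measure \<mu> (M \<union> (\<Union>d\<in>D. d <# M))"
    using M(4) \<F>(3) X fM fU borel_compact[OF C] sets_mu by (intro measure_mono_fmeasurable) auto
  also have "\<dots> \<le> measure \<mu> M + measure \<mu> (\<Union>d\<in>D. d <# M)"
    using fM fU by (intro measure_Un_le) (auto dest: fmeasurableD)
  also have "measure \<mu> (\<Union>d\<in>D. d <# M) \<le> (\<Sum>d\<in>D. measure \<mu> (d <# M))"
    using fdM D(1) by (intro measure_UNION_le) (auto dest: fmeasurableD)
  also have "(\<Sum>d\<in>D. measure \<mu> (d <# M)) = real (card D) * measure \<mu> M"
    using em by (simp add: measure_def)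
  finally have "measure \<mu> C \<le> real (Suc (card D)) * measure \<mu> M" by (simp add: algebra_simps)
  then show ?thesis using that M by blast
qed

section \<open>One stage of the construction\<close>

lemma infinite_nbhd:
  assumes "\<not> openin T {\<one>}" "openin T V" "\<one> \<in> V"
  shows "infinite V"
proof
  assume "finite V"
  then have "closedin T (V - {\<one>})"
    using openin_carrier[OF assms(2)] Hausdorff
    by (intro closedin_Hausdorff_finite) auto
  then have "openin T (V - (V - {\<one>}))" using assms(2) by (rule openin_diff[rotated])
  moreover have "V - (V - {\<one>}) = {\<one>}" using assms(3) by auto
  ultimately show False using assms(1) by simp
qed

text \<open>The disjoint compact sets \<open>d <# B\<close> and \<open>B\<close> have disjoint open
  neighbourhoods. The thickening is wanted because the set removed at a stage must be open for the
  remainder to stay compact.\<close>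

lemma nondisplaced_nbhd:
  assumes "finite D" "D \<subseteq> carrier G" "compactin T B" "\<And>d x. d \<in> D \<Longrightarrow> x \<in> B \<Longrightarrow> d \<otimes> x \<notin> B"
  obtains U where "openin T U" "B \<subseteq> U" "\<And>d x. d \<in> D \<Longrightarrow> x \<in> U \<Longrightarrow> d \<otimes> x \<notin> U"
proof -
  have B: "B \<subseteq> carrier G" using assms compactin_carrier by blast
  have "\<exists>U. openin T U \<and> B \<subseteq> U \<and> (\<forall>x\<in>U. d \<otimes> x \<notin> U)" if d: "d \<in> D" for d
  proof -
    have dc: "d \<in> carrier G" using d assms by auto
    have "(d <# B) \<inter> B = {}" using assms(4)[OF d] by (auto simp: l_coset_def)
    then obtain P Q where PQ: "openin T P" "openin T Q" "d <# B \<subseteq> P" "B \<subseteq> Q" "P \<inter> Q = {}"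
      using compact_separation[OF compactin_lcos[OF assms(3) dc] assms(3)] by metis
    let ?U = "Q \<inter> {x \<in> topspace T. d \<otimes> x \<in> P}"
    have "openin T ?U" using PQ openin_continuous_map_preimage[OF continuous_lmult[OF dc]] by blast
    moreover have "B \<subseteq> ?U" using PQ B by (auto simp: l_coset_def)
    moreover have "\<forall>x\<in>?U. d \<otimes> x \<notin> ?U" using PQ(5) by blast
    ultimately show ?thesis by blast
  qed
  then obtain U where U: "\<And>d. d \<in> D \<Longrightarrow> openin T (U d)" "\<And>d. d \<in> D \<Longrightarrow> B \<subseteq> U d"
    "\<And>d x. d \<in> D \<Longrightarrow> x \<in> U d \<Longrightarrow> d \<otimes> x \<notin> U d" by metis
  show ?thesis
  proof (rule that)
    show "openin T (carrier G \<inter> (\<Inter>d\<in>D. U d))" using assms(1) U(1) by (rule openin_finite_Inter)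
    show "B \<subseteq> carrier G \<inter> (\<Inter>d\<in>D. U d)" using B U(2) by auto
    show "d \<otimes> x \<notin> carrier G \<inter> (\<Inter>d\<in>D. U d)" if "d \<in> D" "x \<in> carrier G \<inter> (\<Inter>d\<in>D. U d)" for d x
      using that U(3)[of d x] by auto
  qed
qed

text \<open>For \<open>D\<close> the set of quotients of distinct elements of \<open>F\<close>,
  independence says that the preimages of \<open>B\<close> under left multiplication by elements of
  \<open>F\<close> are pairwise disjoint. With N = \<open>card F\<close> there are at most N^2 - N
  quotients, whence \<open>Suc (card D)\<close> \<le> N^2; the factor 2 pays for replacing a Borel
  set by a compact one.\<close>

lemma compact_large_independent_set:
  assumes C: "compactin T C" and F: "finite F" "F \<subseteq> carrier G" "F \<noteq> {}"
  obtains B where "compactin T B" "B \<subseteq> C"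
    "\<And>s t x. s \<in> F \<Longrightarrow> t \<in> F \<Longrightarrow> s \<noteq> t \<Longrightarrow> x \<in> B \<Longrightarrow> (t \<otimes> inv s) \<otimes> x \<notin> B"
    "measure \<mu> C \<le> 2 * (real (card F))\<^sup>2 * measure \<mu> B"
proof -
  define R where "R = {(s, t). s \<in> F \<and> t \<in> F \<and> s \<noteq> t}"
  define D where "D = (\<lambda>(s, t). t \<otimes> inv s) ` R"
  have R_eq: "R = F \<times> F - (\<lambda>t. (t, t)) ` F" by (auto simp: R_def)
  then have fR: "finite R" using F by simp
  have D: "finite D" "D \<subseteq> carrier G" using F fR by (auto simp: D_def R_def)
  have D1: "\<one> \<notin> D"
  proof
    assume "\<one> \<in> D"
    then obtain s t where "s \<in> F" "t \<in> F" "s \<noteq> t" "t \<otimes> inv s = \<one>" by (auto simp: D_def R_def)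
    then show False using F(2) by (metis inv_closed inv_equality inv_inv subsetD)
  qed
  have Dinv: "inv d \<in> D" if d: "d \<in> D" for d
  proof -
    obtain s t where st: "(s, t) \<in> R" "d = t \<otimes> inv s" using d by (auto simp: D_def)
    then have "s \<in> carrier G" "t \<in> carrier G" using F(2) by (auto simp: R_def)
    then have "inv d = s \<otimes> inv t" using st by (simp add: inv_mult_group)
    moreover have "(t, s) \<in> R" using st by (auto simp: R_def)
    ultimately show ?thesis unfolding D_def by force
  qed
  have "card R = card F * card F - card F"
    unfolding R_eq using F by (subst card_Diff_subset) (auto simp: card_image inj_on_def card_cartesian_product)
  moreover have "card D \<le> card R" unfolding D_def using fR by (rule card_image_le)
  moreover have "card F \<ge> 1" using F by (simp add: Suc_le_eq card_gt_0_iff)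
  moreover have "card F \<le> card F * card F" by simp
  ultimately have "Suc (card D) \<le> card F * card F" by linarith
  then have cD: "real (Suc (card D)) \<le> (real (card F))\<^sup>2"
    by (simp add: power2_eq_square flip: of_nat_mult del: of_nat_Suc)
  obtain M where M: "M \<in> borel_sets" "M \<subseteq> C" "\<And>d x. d \<in> D \<Longrightarrow> x \<in> M \<Longrightarrow> d \<otimes> x \<notin> M"
    "measure \<mu> C \<le> real (Suc (card D)) * measure \<mu> M"
    using independent_set[OF C D D1 Dinv] by metis
  obtain B where B: "compactin T B" "B \<subseteq> M" "measure \<mu> M \<le> 2 * measure \<mu> B"
  proof (cases "measure \<mu> M = 0")
    case True
    then show ?thesis using that[of "{}"] by simp
  next
    case False
    then have "0 < measure \<mu> M / 2" by (simp add: zero_less_measure_iff)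
    then obtain B where B: "compactin T B" "B \<subseteq> M" "measure \<mu> M \<le> measure \<mu> B + measure \<mu> M / 2"
      using inner_compact[OF C M(1,2)] by metis
    then show ?thesis using that[of B] by simp
  qed
  have "measure \<mu> C \<le> real (Suc (card D)) * measure \<mu> M" by (rule M)
  also have "\<dots> \<le> (real (card F))\<^sup>2 * (2 * measure \<mu> B)" using cD B(3) by (intro mult_mono) auto
  finally have "measure \<mu> C \<le> 2 * (real (card F))\<^sup>2 * measure \<mu> B" by simp
  moreover have "(t \<otimes> inv s) \<otimes> x \<notin> B" if "s \<in> F" "t \<in> F" "s \<noteq> t" "x \<in> B" for s t x
  proof -
    have "t \<otimes> inv s \<in> D" unfolding D_def R_def using that by force
    then show ?thesis using M(3) B(2) that by blast
  qed
  ultimately show ?thesis using that B M(2) by blast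
qed

text \<open>The sets \<open>t\<^sup>-\<^sup>1 L\<close>, for \<open>t\<close> in \<open>F\<close>, are disjoint compact neighbourhoods of the sets
  \<open>t\<^sup>-\<^sup>1 B\<close>; hence every point has a neighbourhood which meets at most one of them.\<close>

lemma perturbation_step:
  assumes nd: "\<not> openin T {\<one>}" and C: "compactin T C" and K: "compactin T K"
    and V: "openin T V" "\<one> \<in> V" and S: "finite S" "S \<subseteq> carrier G" and N: "0 < N"
  obtains F V' W B E where
    "finite F" "F \<subseteq> carrier G" "card F = N"
    "openin T V'" "\<one> \<in> V'" "compactin T W" "V' \<subseteq> W" "W <#> F \<subseteq> V" "openin T B"
    "2 * (real N)\<^sup>2 * measure \<mu> (C - B) \<le> (2 * (real N)\<^sup>2 - 1) * measure \<mu> C"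
    "K \<subseteq> (\<Union>k::nat. E k)" "\<And>k. E k \<subseteq> carrier G"
    "\<And>k s t t' r r' x x'. s \<in> S \<Longrightarrow> t \<in> F \<Longrightarrow> t' \<in> F \<Longrightarrow> r \<in> W \<Longrightarrow> r' \<in> W \<Longrightarrow> x \<in> E k \<Longrightarrow> x' \<in> E k \<Longrightarrow>
       r \<otimes> ((t \<otimes> s) \<otimes> x) \<in> B \<Longrightarrow> r' \<otimes> ((t' \<otimes> s) \<otimes> x') \<in> B \<Longrightarrow> t = t'"
proof -
  have Kc: "K \<subseteq> carrier G" using K compactin_carrier by blast
  \<comment> \<open>One factor of the room in \<open>V\<close> goes to \<open>F\<close>, the other
    to the later perturbations in \<open>W\<close>.\<close>
  obtain V1 where V1: "openin T V1" "\<one> \<in> V1" "\<And>x y. x \<in> V1 \<Longrightarrow> y \<in> V1 \<Longrightarrow> x \<otimes> y \<in> V"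
    using nbhd_split[OF V] by metis
  obtain F where F: "F \<subseteq> V1" "finite F" "card F = N"
    using infinite_arbitrarily_large[OF infinite_nbhd[OF nd V1(1,2)]] by metis
  have Fc: "F \<subseteq> carrier G" using F V1 openin_carrier by blast
  have Fne: "F \<noteq> {}" using F N by auto
  obtain B0 where B0: "compactin T B0" "B0 \<subseteq> C"
    "\<And>s t x. s \<in> F \<Longrightarrow> t \<in> F \<Longrightarrow> s \<noteq> t \<Longrightarrow> x \<in> B0 \<Longrightarrow> (t \<otimes> inv s) \<otimes> x \<notin> B0"
    "measure \<mu> C \<le> 2 * (real N)\<^sup>2 * measure \<mu> B0"
    using compact_large_independent_set[OF C F(2) Fc Fne] F(3) by metis
  have B0c: "B0 \<subseteq> carrier G" using B0 compactin_carrier by blast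
  define D where "D = {t \<otimes> inv s |s t. s \<in> F \<and> t \<in> F \<and> s \<noteq> t}"
  have "D \<subseteq> (\<lambda>(s, t). t \<otimes> inv s) ` (F \<times> F)" by (auto simp: D_def)
  then have D: "finite D" using F(2) finite_subset by blast
  have Dc: "D \<subseteq> carrier G" using Fc by (auto simp: D_def)
  obtain U where U: "openin T U" "B0 \<subseteq> U" "\<And>d x. d \<in> D \<Longrightarrow> x \<in> U \<Longrightarrow> d \<otimes> x \<notin> U"
    by (rule nondisplaced_nbhd[OF D Dc B0(1)]) (use B0(3) in \<open>auto simp: D_def\<close>)
  obtain Q where Q: "openin T Q" "\<one> \<in> Q" "Q <#> B0 \<subseteq> U" using nbhd_compact_left[OF B0(1) U(1,2)] by metis
  obtain Qo Qc where Qc: "openin T Qo" "compactin T Qc" "\<one> \<in> Qo" "Qo \<subseteq> Qc" "Qc \<subseteq> Q"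
    using compact_nbhd[OF Q(1,2)] by metis
  \<comment> \<open>A compact thickening of \<open>B0\<close> inside \<open>U\<close>, whose
    preimages under \<open>F\<close> are therefore still disjoint. The removed set
    \<open>R <#> B0\<close> is thinner, with products of two elements of \<open>R\<close> in
    \<open>Qc\<close>: this margin absorbs a later perturbation from \<open>R\<close>.\<close>
  define L where "L = Qc <#> B0"
  have L: "compactin T L" using Qc B0 compactin_set_mult by (simp add: L_def)
  have LU: "L \<subseteq> U" using set_mult_mono[OF Qc(5) order_refl] Q(3) unfolding L_def by blast
  have Ldisj: "t = t'" if "t \<in> F" "t' \<in> F" "y \<in> carrier G" "t \<otimes> y \<in> L" "t' \<otimes> y \<in> L" for t t' y
  proof (rule ccontr)
    assume "t \<noteq> t'"
    then have d: "t' \<otimes> inv t \<in> D" using that by (auto simp: D_def)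
    have c: "t \<in> carrier G" "t' \<in> carrier G" using that Fc by auto
    have "(t' \<otimes> inv t) \<otimes> (t \<otimes> y) = t' \<otimes> y" using c that(3) by (simp add: m_assoc mult_inv_cancel)
    then show False using U(3)[OF d, of "t \<otimes> y"] that LU by auto
  qed
  obtain R where R: "openin T R" "\<one> \<in> R" "\<And>x. x \<in> R \<Longrightarrow> inv x \<in> R"
    "\<And>x y. x \<in> R \<Longrightarrow> y \<in> R \<Longrightarrow> x \<otimes> y \<in> Qo" using nbhd_split[OF Qc(1,3)] by metis
  have Rc: "R \<subseteq> carrier G" using R openin_carrier by blast
  define B where "B = R <#> B0"
  have B: "openin T B" using R B0c openin_set_mult_left by (simp add: B_def)
  have B0B: "B0 \<subseteq> B" using R(2) B0c by (force simp: B_def set_mult_def)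
  obtain V' W where W: "openin T V'" "compactin T W" "\<one> \<in> V'" "V' \<subseteq> W" "W \<subseteq> R \<inter> V1"
    using compact_nbhd[of "R \<inter> V1" \<one>] R V1 by (metis IntI openin_Int)
  have RB: "y \<in> L" if r: "r \<in> R" and y: "y \<in> carrier G" and ry: "r \<otimes> y \<in> B" for r y
  proof -
    obtain q b where qb: "q \<in> R" "b \<in> B0" "r \<otimes> y = q \<otimes> b" using ry by (auto simp: B_def set_mult_def)
    have c: "r \<in> carrier G" "q \<in> carrier G" "b \<in> carrier G" using r qb Rc B0c by auto
    have "y = inv r \<otimes> (q \<otimes> b)" unfolding qb(3)[symmetric] using c y by (simp add: mult_inv_cancel)
    also have "\<dots> = (inv r \<otimes> q) \<otimes> b" using c by (simp add: m_assoc)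
    finally have "y = (inv r \<otimes> q) \<otimes> b" .
    moreover have "inv r \<otimes> q \<in> Qc" using R(3,4) r qb Qc(4) by blast
    ultimately show ?thesis using qb(2) unfolding L_def set_mult_def by blast
  qed
  \<comment> \<open>A product \<open>p\<close> that keeps \<open>x\<close> out of \<open>L\<close>
    keeps all of \<open>Nb x\<close> out of \<open>L\<close>. Conversely, if \<open>p\<close> sends
    some point of \<open>Nb x\<close> into \<open>L\<close>, it sends \<open>x\<close>
    there.\<close>
  define P where "P x = {p \<in> F <#> S. p \<otimes> x \<notin> L}" for x
  define Nb where "Nb x = carrier G \<inter> (\<Inter>p\<in>P x. {y \<in> topspace T. p \<otimes> y \<in> carrier G - L})" for x
  have FS: "finite (F <#> S)" "F <#> S \<subseteq> carrier G"
  proof -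
    have "F <#> S = (\<lambda>(x, y). x \<otimes> y) ` (F \<times> S)" by (auto simp: set_mult_def)
    then show "finite (F <#> S)" using F S by simp
    show "F <#> S \<subseteq> carrier G" using Fc S(2) by (rule set_mult_closed)
  qed
  have oL: "openin T (carrier G - L)" using openin_diff[OF openin_top compactin_closedin[OF L]] .
  have oNb: "openin T (Nb x)" for x
    unfolding Nb_def
  proof (rule openin_finite_Inter)
    show "finite (P x)" using FS by (simp add: P_def)
    show "openin T {y \<in> topspace T. p \<otimes> y \<in> carrier G - L}" if "p \<in> P x" for p
      using that FS by (intro openin_continuous_map_preimage[OF continuous_lmult oL]) (auto simp: P_def)
  qed
  have xNb: "x \<in> Nb x" if "x \<in> K" for x
    using that Kc FS(2) by (auto simp: Nb_def P_def)
  obtain \<F> where \<F>: "finite \<F>" "\<F> \<subseteq> Nb ` K" "K \<subseteq> \<Union>\<F>"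
  proof -
    have "\<And>U. U \<in> Nb ` K \<Longrightarrow> openin T U" "K \<subseteq> \<Union>(Nb ` K)" using oNb xNb by auto
    then show ?thesis using K that unfolding compactin_def by meson
  qed
  then obtain X where X: "finite X" "X \<subseteq> K" "\<F> = Nb ` X" by (metis finite_subset_image)
  obtain xs where xs: "set xs = X" using finite_list[OF X(1)] by blast
  \<comment> \<open>The finite cover is listed as a sequence padded with empty sets, since slaloms
    are about natural numbers.\<close>
  define E where "E k = (if k < length xs then Nb (xs ! k) else {})" for k
  have KE: "K \<subseteq> (\<Union>k. E k)"
  proof
    fix y assume "y \<in> K"
    then obtain x where "x \<in> X" "y \<in> Nb x" using \<F> X by auto
    then obtain k where "k < length xs" "y \<in> Nb (xs ! k)" using xs by (metis in_set_conv_nth)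
    then show "y \<in> (\<Union>k. E k)" by (auto simp: E_def intro!: exI[of _ k])
  qed
  have Ec: "E k \<subseteq> carrier G" for k by (auto simp: E_def Nb_def)
  \<comment> \<open>A hit of \<open>B\<close> anywhere in \<open>E k\<close> is traced back to the
    centre \<open>xs ! k\<close> and the larger set \<open>L\<close>. Two hits with the same
    \<open>s\<close> thus concern the same point, and disjointness of the preimages of
    \<open>L\<close> leaves one \<open>t\<close>.\<close>
  have hit: "(t \<otimes> s) \<otimes> xs ! k \<in> L"
    if "s \<in> S" "t \<in> F" "r \<in> W" "x \<in> E k" "r \<otimes> ((t \<otimes> s) \<otimes> x) \<in> B" for k s t r x
  proof (rule ccontr)
    assume "(t \<otimes> s) \<otimes> xs ! k \<notin> L"
    moreover have ts: "t \<otimes> s \<in> F <#> S" using that by (auto simp: set_mult_def)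
    ultimately have "t \<otimes> s \<in> P (xs ! k)" by (simp add: P_def)
    moreover have "x \<in> Nb (xs ! k)" using that(4) by (simp add: E_def split: if_splits)
    ultimately have "(t \<otimes> s) \<otimes> x \<notin> L" by (auto simp: Nb_def)
    moreover have "(t \<otimes> s) \<otimes> x \<in> carrier G" using ts FS(2) Ec that(4) by blast
    ultimately show False using RB[of r "(t \<otimes> s) \<otimes> x"] that W(5) by blast
  qed
  have unique: "t = t'" if "s \<in> S" "t \<in> F" "t' \<in> F" "r \<in> W" "r' \<in> W" "x \<in> E k" "x' \<in> E k"
    "r \<otimes> ((t \<otimes> s) \<otimes> x) \<in> B" "r' \<otimes> ((t' \<otimes> s) \<otimes> x') \<in> B" for k s t t' r r' x x'
  proof -
    have "(t \<otimes> s) \<otimes> xs ! k \<in> L" "(t' \<otimes> s) \<otimes> xs ! k \<in> L" using hit that by blast+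
    moreover have "k < length xs" using that(6) by (simp add: E_def split: if_splits)
    then have "xs ! k \<in> carrier G" using xs X Kc nth_mem by blast
    moreover have "t \<in> carrier G" "t' \<in> carrier G" "s \<in> carrier G" using that Fc S by auto
    ultimately show ?thesis using Ldisj[of t t' "s \<otimes> xs ! k"] that by (simp add: m_assoc)
  qed
  have WF: "W <#> F \<subseteq> V" using V1(3) W(5) F(1) unfolding set_mult_def by blast
  have meas: "2 * (real N)\<^sup>2 * measure \<mu> (C - B) \<le> (2 * (real N)\<^sup>2 - 1) * measure \<mu> C"
  proof -
    have f: "C \<in> fmeasurable \<mu>" "B0 \<in> fmeasurable \<mu>" using C B0 fmeasurable_compact by auto
    have "measure \<mu> (C - B) \<le> measure \<mu> (C - B0)"
      using f B0B fmeasurable_compact[OF compactin_diff[OF C B]]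
      by (intro measure_mono_fmeasurable) (auto dest: fmeasurableD)
    also have "\<dots> = measure \<mu> C - measure \<mu> B0"
      using f B0(2) by (intro measurable_measure_Diff) (auto dest: fmeasurableD)
    finally have "2 * (real N)\<^sup>2 * measure \<mu> (C - B) \<le> 2 * (real N)\<^sup>2 * (measure \<mu> C - measure \<mu> B0)"
      by (intro mult_left_mono) auto
    then show ?thesis using B0(4) by (simp add: algebra_simps)
  qed
  show ?thesis
    by (rule that[OF F(2) Fc F(3) W(1,3,2,4) WF B meas KE Ec unique])
qed

text \<open>The stages are built once for all slaloms; \<open>S n\<close> collects every composition
  of perturbations up to that point. A slalom then selects one \<open>s n\<close> in each
  \<open>S n\<close>, and a point \<open>a\<close> common to the nested compact sets
  \<open>W n #> s n\<close> moves all captured points of \<open>K\<close> into the null intersection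
  \<open>D\<close>. Translates of \<open>D\<close> by the inverses of these points cover
  \<open>K\<close>.\<close>

lemma null_compact_translates_cover:
  assumes nd: "\<not> openin T {\<one>}" and K: "compactin T K"
  obtains C A where "compactin T C" "C \<in> null_sets \<mu>" "A \<subseteq> carrier G" "|A| \<le>o cof_null"
    "K \<subseteq> (\<Union>a\<in>A. a <# C)"
proof -
  have Kc: "K \<subseteq> carrier G" using K compactin_carrier by blast
  obtain V0 W0 where W0: "openin T V0" "compactin T W0" "\<one> \<in> V0" "V0 \<subseteq> W0"
    using compact_nbhd[OF openin_top one_closed] by metis
  \<comment> \<open>\<open>P\<close> is the invariant of a state and \<open>Q\<close> the
    transition. State \<open>Suc n\<close> stores the \<open>F\<close>, \<open>B\<close> and
    \<open>E\<close> made at stage \<open>n\<close> with \<open>width n\<close>; in state 0 these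
    three entries are placeholders.\<close>
  define P where "P = (\<lambda>n::nat. \<lambda>(V, C, S, W, F :: 'a set, B :: 'a set, E :: nat \<Rightarrow> 'a set).
    openin T V \<and> \<one> \<in> V \<and> compactin T C \<and> finite S \<and> S \<subseteq> carrier G \<and> V \<subseteq> W \<and> compactin T W)"
  define Q where "Q = (\<lambda>n. \<lambda>(V, C, S, W :: 'a set, F :: 'a set, B :: 'a set, E :: nat \<Rightarrow> 'a set).
    \<lambda>(V' :: 'a set, C', S', W', F', B', E' :: nat \<Rightarrow> 'a set).
    C' = C - B' \<and> S' = F' <#> S \<and> F' \<subseteq> carrier G \<and> card F' = Suc (width n) \<and> W' <#> F' \<subseteq> V \<and>
    openin T B' \<and>
    2 * (real (Suc (width n)))\<^sup>2 * measure \<mu> C' \<le> (2 * (real (Suc (width n)))\<^sup>2 - 1) * measure \<mu> C \<and>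
    K \<subseteq> (\<Union>k. E' k) \<and> (\<forall>k. E' k \<subseteq> carrier G) \<and>
    (\<forall>k. \<forall>s\<in>S. \<forall>t\<in>F'. \<forall>t'\<in>F'. \<forall>r\<in>W'. \<forall>r'\<in>W'. \<forall>x\<in>E' k. \<forall>x'\<in>E' k.
       r \<otimes> ((t \<otimes> s) \<otimes> x) \<in> B' \<longrightarrow> r' \<otimes> ((t' \<otimes> s) \<otimes> x') \<in> B' \<longrightarrow> t = t'))"
  have "\<exists>f. P 0 (f 0) \<and> (\<forall>n. P n (f n) \<and> Q n (f n) (f (Suc n))) \<and>
    f 0 = (V0, W0 <#> K, {\<one>}, W0, {}, {}, \<lambda>_. {})"
  proof -
    \<comment> \<open>Pins down the initial state. Starting from \<open>W0 <#> K\<close> ensures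
      that \<open>a \<otimes> x\<close> lies in the first compact set whenever \<open>a\<close> is
      in \<open>W0\<close> and \<open>x\<close> in \<open>K\<close>.\<close>
    define P' where "P' n x \<longleftrightarrow> P n x \<and> (n = 0 \<longrightarrow> x = (V0, W0 <#> K, {\<one>}, W0, {}, {}, \<lambda>_. {}))" for n x
    have "\<exists>f. \<forall>n. P' n (f n) \<and> Q n (f n) (f (Suc n))"
    proof (rule dependent_nat_choice)
      show "\<exists>x. P' 0 x"
        using W0 K compactin_set_mult by (auto simp: P'_def P_def)
    next
      fix x n assume "P' n x"
      then obtain V C S W F B E where x: "x = (V, C, S, W, F, B, E)" and
        p: "openin T V" "\<one> \<in> V" "compactin T C" "finite S" "S \<subseteq> carrier G"
        by (cases x) (auto simp: P'_def P_def)
      obtain F' V' W' B' E' where step: "finite F'" "F' \<subseteq> carrier G" "card F' = Suc (width n)"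
        "openin T V'" "\<one> \<in> V'" "compactin T W'" "V' \<subseteq> W'" "W' <#> F' \<subseteq> V" "openin T B'"
        "2 * (real (Suc (width n)))\<^sup>2 * measure \<mu> (C - B') \<le> (2 * (real (Suc (width n)))\<^sup>2 - 1) * measure \<mu> C"
        "K \<subseteq> (\<Union>k::nat. E' k)" "\<And>k. E' k \<subseteq> carrier G"
        "\<And>k s t t' r r' x x'. s \<in> S \<Longrightarrow> t \<in> F' \<Longrightarrow> t' \<in> F' \<Longrightarrow> r \<in> W' \<Longrightarrow> r' \<in> W' \<Longrightarrow> x \<in> E' k \<Longrightarrow> x' \<in> E' k \<Longrightarrow>
           r \<otimes> ((t \<otimes> s) \<otimes> x) \<in> B' \<Longrightarrow> r' \<otimes> ((t' \<otimes> s) \<otimes> x') \<in> B' \<Longrightarrow> t = t'"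
        by (rule perturbation_step[OF nd p(3) K p(1,2,4,5) zero_less_Suc[of "width n"]]) (rule that; assumption)
      have FS: "finite (F' <#> S)" "F' <#> S \<subseteq> carrier G"
      proof -
        have "F' <#> S = (\<lambda>(x, y). x \<otimes> y) ` (F' \<times> S)" by (auto simp: set_mult_def)
        then show "finite (F' <#> S)" using step(1) p(4) by simp
        show "F' <#> S \<subseteq> carrier G" using step(2) p(5) by (rule set_mult_closed)
      qed
      let ?y = "(V', C - B', F' <#> S, W', F', B', E')"
      have "P' (Suc n) ?y"
        using step FS compactin_diff[OF p(3) step(9)] by (simp add: P'_def P_def)
      moreover have "Q n x ?y"
        unfolding x Q_def prod.case
        by (intro conjI allI ballI impI refl step(2,3,8-12)) (rule step(13))
      ultimately show "\<exists>y. P' (Suc n) y \<and> Q n x y" by blast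
    qed
    then show ?thesis by (auto simp: P'_def)
  qed
  then obtain f where f: "\<And>n. P n (f n)" "\<And>n. Q n (f n) (f (Suc n))"
    "f 0 = (V0, W0 <#> K, {\<one>}, W0, {}, {}, \<lambda>_. {})" by blast
  define V where "V n = fst (f n)" for n
  define C where "C n = fst (snd (f n))" for n
  define S where "S n = fst (snd (snd (f n)))" for n
  define W where "W n = fst (snd (snd (snd (f n))))" for n
  define F where "F n = fst (snd (snd (snd (snd (f n)))))" for n
  define B where "B n = fst (snd (snd (snd (snd (snd (f n))))))" for n
  define E where "E n = snd (snd (snd (snd (snd (snd (f n))))))" for n
  have f_eq: "f n = (V n, C n, S n, W n, F n, B n, E n)" for n
    by (simp add: V_def C_def S_def W_def F_def B_def E_def)
  have p: "openin T (V n)" "\<one> \<in> V n" "compactin T (C n)" "finite (S n)" "S n \<subseteq> carrier G" "V n \<subseteq> W n"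
    "compactin T (W n)" for n
    using f(1)[of n] unfolding f_eq P_def by auto
  have q: "C (Suc n) = C n - B (Suc n)" "S (Suc n) = F (Suc n) <#> S n" "F (Suc n) \<subseteq> carrier G"
    "card (F (Suc n)) = Suc (width n)" "W (Suc n) <#> F (Suc n) \<subseteq> V n" "openin T (B (Suc n))"
    "2 * (real (Suc (width n)))\<^sup>2 * measure \<mu> (C (Suc n)) \<le> (2 * (real (Suc (width n)))\<^sup>2 - 1) * measure \<mu> (C n)"
    "K \<subseteq> (\<Union>k. E (Suc n) k)" "E (Suc n) k \<subseteq> carrier G" for n k
    using f(2)[of n] unfolding f_eq Q_def prod.case by - (elim conjE, (assumption | erule spec))+
  have unique: "t = t'" if "s \<in> S n" "t \<in> F (Suc n)" "t' \<in> F (Suc n)" "r \<in> W (Suc n)" "r' \<in> W (Suc n)"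
    "x \<in> E (Suc n) k" "x' \<in> E (Suc n) k" "r \<otimes> ((t \<otimes> s) \<otimes> x) \<in> B (Suc n)"
    "r' \<otimes> ((t' \<otimes> s) \<otimes> x') \<in> B (Suc n)" for n k s t t' r r' x x'
  proof -
    have "\<forall>k. \<forall>s\<in>S n. \<forall>t\<in>F (Suc n). \<forall>t'\<in>F (Suc n). \<forall>r\<in>W (Suc n). \<forall>r'\<in>W (Suc n).
        \<forall>x\<in>E (Suc n) k. \<forall>x'\<in>E (Suc n) k. r \<otimes> ((t \<otimes> s) \<otimes> x) \<in> B (Suc n) \<longrightarrow>
          r' \<otimes> ((t' \<otimes> s) \<otimes> x') \<in> B (Suc n) \<longrightarrow> t = t'"
      using f(2)[of n] unfolding f_eq Q_def prod.case by - (elim conjE, assumption)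
    from this[rule_format, OF that] show ?thesis .
  qed
  have init: "C 0 = W 0 <#> K" "S 0 = {\<one>}" using f(3) by (simp_all add: C_def S_def W_def)
  have Wc: "W n \<subseteq> carrier G" for n using p(7) compactin_carrier by blast
  have Bc: "B (Suc n) \<subseteq> carrier G" for n using q(6) openin_carrier by blast
  \<comment> \<open>The factors 1 - 1/(j + 8) = (j + 7)/(j + 8) over j < n multiply to 7/(n +
    7).\<close>
  have meas: "measure \<mu> (C n) \<le> 7 / (real n + 7) * measure \<mu> (C 0)" for n
  proof (induction n)
    case (Suc n)
    define N where "N = 2 * (real (Suc (width n)))\<^sup>2"
    have N: "0 < N" "N \<le> real n + 8"
    proof -
      show "0 < N" by (simp add: N_def)
      have "real (2 * (Suc (width n))\<^sup>2) \<le> real (n + 8)" using width(2)[of n] by (rule of_nat_mono)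
      then show "N \<le> real n + 8" by (simp add: N_def)
    qed
    have "measure \<mu> (C (Suc n)) \<le> (1 - 1 / N) * measure \<mu> (C n)"
      using q(7)[of n] N(1) unfolding N_def[symmetric] by (simp add: field_simps)
    also have "\<dots> \<le> (1 - 1 / (real n + 8)) * measure \<mu> (C n)"
      using N by (intro mult_right_mono) (auto simp: frac_le)
    also have "\<dots> \<le> (1 - 1 / (real n + 8)) * (7 / (real n + 7) * measure \<mu> (C 0))"
      by (intro mult_left_mono Suc.IH) simp
    also have "\<dots> = 7 / (real (Suc n) + 7) * measure \<mu> (C 0)" by (simp add: divide_simps) (simp add: algebra_simps)
    finally show ?case .
  qed simp
  define D where "D = (\<Inter>n. C n)"
  have "closedin T D" unfolding D_def using compactin_closedin[OF p(3)] by (intro closedin_Inter) auto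
  moreover have "D \<subseteq> C 0" unfolding D_def by blast
  ultimately have D: "compactin T D" using closed_compactin[OF p(3)[of 0]] by blast
  have "measure \<mu> D = 0"
  proof (rule ccontr)
    assume "measure \<mu> D \<noteq> 0"
    then have pos: "0 < measure \<mu> D" by (simp add: zero_less_measure_iff)
    have le: "measure \<mu> D \<le> 7 / (real n + 7) * measure \<mu> (C 0)" for n
    proof -
      have "measure \<mu> D \<le> measure \<mu> (C n)"
        using fmeasurable_compact[OF D] fmeasurable_compact[OF p(3)[of n]]
        by (intro measure_mono_fmeasurable) (auto simp: D_def dest: fmeasurableD)
      then show ?thesis using meas[of n] by linarith
    qed
    obtain n :: nat where n: "7 * measure \<mu> (C 0) / measure \<mu> D < real n" using reals_Archimedean2 by blast
    then have "7 * measure \<mu> (C 0) < real n * measure \<mu> D" using pos by (simp add: pos_divide_less_eq)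
    moreover have "measure \<mu> D * (real n + 7) \<le> 7 * measure \<mu> (C 0)"
      using le[of n] by (simp add: field_simps)
    ultimately show False using pos by (simp add: algebra_simps)
  qed
  then have Dnull: "D \<in> null_sets \<mu>"
    using fmeasurable_compact[OF D] by (auto simp: null_sets_def emeasure_eq_measure2 dest: fmeasurableD)
  obtain \<S> :: "(nat \<Rightarrow> nat set) set" where \<S>: "|\<S>| \<le>o cof_null"
    "\<And>R n. R \<in> \<S> \<Longrightarrow> finite (R n) \<and> card (R n) \<le> width n" "\<And>f. \<exists>R\<in>\<S>. \<forall>n. f n \<in> R n"
    using slaloms[OF width(3,1)] by metis
  have key: "\<exists>a\<in>carrier G. \<forall>x\<in>K. (\<forall>n. \<exists>k\<in>R n. x \<in> E (Suc n) k) \<longrightarrow> a \<otimes> x \<in> D" if R: "R \<in> \<S>" for R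
  proof -
    have "\<exists>s. \<forall>n. (s n \<in> S n \<and> (n = 0 \<longrightarrow> s n = \<one>)) \<and> (\<exists>u\<in>F (Suc n). s (Suc n) = u \<otimes> s n \<and>
        (\<forall>k\<in>R n. \<forall>x\<in>E (Suc n) k. \<forall>r\<in>W (Suc n). r \<otimes> (s (Suc n) \<otimes> x) \<notin> B (Suc n)))"
    proof (rule dependent_nat_choice)
      show "\<exists>x. x \<in> S 0 \<and> (0 = 0 \<longrightarrow> x = \<one>)" using init by simp
    next
      fix s n assume s: "s \<in> S n \<and> (n = 0 \<longrightarrow> s = \<one>)"
      \<comment> \<open>The candidates that would bring some point of \<open>E (Suc n) k\<close>
        into the removed set after some later perturbation \<open>r\<close>; by
        \<open>unique\<close> there is at most one for each \<open>k\<close>. The at most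
        \<open>width n\<close> values of \<open>k\<close> in the slalom cannot rule out all
        \<open>Suc (width n)\<close> candidates.\<close>
      define bad where "bad k = {t \<in> F (Suc n). \<exists>x\<in>E (Suc n) k. \<exists>r\<in>W (Suc n). r \<otimes> ((t \<otimes> s) \<otimes> x) \<in> B (Suc n)}" for k
      have bad1: "card (bad k) \<le> 1" for k
      proof -
        have "t = t'" if t: "t \<in> bad k" and t': "t' \<in> bad k" for t t'
        proof -
          obtain x r where 1: "t \<in> F (Suc n)" "x \<in> E (Suc n) k" "r \<in> W (Suc n)" "r \<otimes> ((t \<otimes> s) \<otimes> x) \<in> B (Suc n)"
            using t by (auto simp: bad_def)
          obtain x' r' where 2: "t' \<in> F (Suc n)" "x' \<in> E (Suc n) k" "r' \<in> W (Suc n)"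
            "r' \<otimes> ((t' \<otimes> s) \<otimes> x') \<in> B (Suc n)"
            using t' by (auto simp: bad_def)
          from unique[OF _ 1(1) 2(1) 1(3) 2(3) 1(2) 2(2) 1(4) 2(4)] s show ?thesis by blast
        qed
        then have "bad k \<subseteq> {t}" if "t \<in> bad k" for t using that by blast
        then have "bad k = {} \<or> (\<exists>t. bad k = {t})" by blast
        then show ?thesis by auto
      qed
      have "card (\<Union>k\<in>R n. bad k) \<le> (\<Sum>k\<in>R n. card (bad k))"
        using \<S>(2)[OF R] by (intro card_UN_le) simp
      also have "\<dots> \<le> (\<Sum>k\<in>R n. 1)" by (intro sum_mono bad1)
      also have "\<dots> \<le> width n" using \<S>(2)[OF R, of n] by simp
      finally have less: "card (\<Union>k\<in>R n. bad k) < card (F (Suc n))" using q(4)[of n] by simp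
      have "\<not> F (Suc n) \<subseteq> (\<Union>k\<in>R n. bad k)"
      proof
        assume "F (Suc n) \<subseteq> (\<Union>k\<in>R n. bad k)"
        then have "F (Suc n) = (\<Union>k\<in>R n. bad k)" by (auto simp: bad_def)
        then show False using less by simp
      qed
      then obtain u where u: "u \<in> F (Suc n)" "\<And>k. k \<in> R n \<Longrightarrow> u \<notin> bad k" by blast
      have "u \<otimes> s \<in> S (Suc n)" using u s q(2) by (auto simp: set_mult_def)
      moreover have "\<forall>k\<in>R n. \<forall>x\<in>E (Suc n) k. \<forall>r\<in>W (Suc n). r \<otimes> ((u \<otimes> s) \<otimes> x) \<notin> B (Suc n)"
        using u unfolding bad_def by blast
      ultimately show "\<exists>s'. (s' \<in> S (Suc n) \<and> (Suc n = 0 \<longrightarrow> s' = \<one>)) \<and> (\<exists>u\<in>F (Suc n). s' = u \<otimes> s \<and>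
        (\<forall>k\<in>R n. \<forall>x\<in>E (Suc n) k. \<forall>r\<in>W (Suc n). r \<otimes> (s' \<otimes> x) \<notin> B (Suc n)))"
        using u(1) by blast
    qed
    then obtain s where s: "\<And>n. s n \<in> S n" "s 0 = \<one>"
      "\<And>n. \<exists>u\<in>F (Suc n). s (Suc n) = u \<otimes> s n"
      "\<And>n k x r. k \<in> R n \<Longrightarrow> x \<in> E (Suc n) k \<Longrightarrow> r \<in> W (Suc n) \<Longrightarrow> r \<otimes> (s (Suc n) \<otimes> x) \<notin> B (Suc n)"
      by metis
    have sc: "s n \<in> carrier G" for n using s(1) p(5) by blast
    \<comment> \<open>The translates are nested because
      \<open>W (Suc n) <#> F (Suc n) \<subseteq> V n \<subseteq> W n\<close>. The point
      \<open>a\<close> plays the part of a limit of the products \<open>s n\<close>.\<close>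
    obtain a where a: "\<And>n. a \<in> W n #> s n"
    proof (rule nested_compact_nonempty[of "\<lambda>n. W n #> s n"])
      fix n
      have "W n #> s n = (\<lambda>x. x \<otimes> s n) ` W n" by (auto simp: r_coset_def)
      then show "compactin T (W n #> s n)" using image_compactin[OF p(7) continuous_rmult[OF sc]] by simp
      show "W n #> s n \<noteq> {}" using p(2,6) by (auto simp: r_coset_def)
      show "W (Suc n) #> s (Suc n) \<subseteq> W n #> s n"
      proof
        fix y assume "y \<in> W (Suc n) #> s (Suc n)"
        then obtain r where r: "r \<in> W (Suc n)" "y = r \<otimes> s (Suc n)" by (auto simp: r_coset_def)
        obtain u where u: "u \<in> F (Suc n)" "s (Suc n) = u \<otimes> s n" using s(3) by blast
        have "r \<in> carrier G" "u \<in> carrier G" using r u Wc q(3) by auto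
        then have "y = (r \<otimes> u) \<otimes> s n" using r u sc by (simp add: m_assoc)
        moreover have "r \<otimes> u \<in> W n" using r u q(5) p(6) unfolding set_mult_def by blast
        ultimately show "y \<in> W n #> s n" unfolding r_coset_def by blast
      qed
    qed blast
    have a0: "a \<in> W 0" using a[of 0] s(2) coset_mult_one[OF Wc] by simp
    have ac: "a \<in> carrier G" using a0 Wc by blast
    have "a \<otimes> x \<in> D" if x: "x \<in> K" and cap: "\<And>n. \<exists>k\<in>R n. x \<in> E (Suc n) k" for x
    proof -
      have xc: "x \<in> carrier G" using x Kc by blast
      \<comment> \<open>Everything that happens after stage \<open>n\<close> is summed up in a
        single \<open>r\<close> in \<open>W (Suc n)\<close>, and \<open>s (Suc n)\<close> was chosen
        against all such \<open>r\<close>.\<close>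
      have "a \<otimes> x \<notin> B (Suc n)" for n
      proof -
        obtain r where r: "r \<in> W (Suc n)" "a = r \<otimes> s (Suc n)" using a[of "Suc n"] by (auto simp: r_coset_def)
        obtain k where k: "k \<in> R n" "x \<in> E (Suc n) k" using cap by blast
        have "r \<in> carrier G" using r Wc by blast
        then show ?thesis using s(4)[OF k r(1)] r(2) sc xc by (simp add: m_assoc)
      qed
      then have "a \<otimes> x \<in> C n" for n
      proof (induction n)
        case 0
        then show ?case using init(1) a0 x by (auto simp: set_mult_def)
      qed (simp add: q(1))
      then show ?thesis by (simp add: D_def)
    qed
    then show ?thesis using ac by blast
  qed
  then obtain a where a: "\<And>R. R \<in> \<S> \<Longrightarrow> a R \<in> carrier G"
    "\<And>R x. R \<in> \<S> \<Longrightarrow> x \<in> K \<Longrightarrow> \<forall>n. \<exists>k\<in>R n. x \<in> E (Suc n) k \<Longrightarrow> a R \<otimes> x \<in> D" by metis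
  let ?A = "(\<lambda>R. inv (a R)) ` \<S>"
  have "K \<subseteq> (\<Union>b\<in>?A. b <# D)"
  proof
    fix x assume x: "x \<in> K"
    have "\<exists>k. x \<in> E (Suc n) k" for n using q(8)[of n] x by blast
    \<comment> \<open>The code of \<open>x\<close>: at each stage the index of a member of the cover
      that contains \<open>x\<close>.\<close>
    then obtain g where g: "\<And>n. x \<in> E (Suc n) (g n)" by metis
    obtain R where R: "R \<in> \<S>" "\<forall>n. g n \<in> R n" using \<S>(3) by blast
    have ax: "a R \<otimes> x \<in> D" using a(2)[OF R(1) x] R(2) g by blast
    have "x = inv (a R) \<otimes> (a R \<otimes> x)" using a(1)[OF R(1)] x Kc by (simp add: mult_inv_cancel subsetD)
    then have "x \<in> inv (a R) <# D" using ax unfolding l_coset_def by blast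
    then show "x \<in> (\<Union>b\<in>?A. b <# D)" using R(1) by blast
  qed
  moreover have "|?A| \<le>o cof_null" using card_of_image \<S>(1) ordLeq_transitive by blast
  moreover have "?A \<subseteq> carrier G" using a(1) by auto
  ultimately show ?thesis using that D Dnull by blast
qed

end

section \<open>From a compact set to the whole group\<close>

context lc_group
begin

text \<open>Finitely many translates \<open>f <# V\<close> cover \<open>K <#> K\<close>. Let
  \<open>E\<close> be the set of all finite products from \<open>F\<close>; then
  \<open>e \<otimes> k \<otimes> v = e \<otimes> f \<otimes> w\<close> with \<open>w\<close> in
  \<open>V \<subseteq> K\<close>, so right multiplication by \<open>V\<close> maps
  \<open>E <#> K\<close> into itself. Hence the generated subgroup never leaves it.\<close>

lemma generated_countable_cover:
  assumes K: "compactin T K" and V: "openin T V" "\<one> \<in> V" "V \<subseteq> K" "\<And>x. x \<in> V \<Longrightarrow> inv x \<in> V"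
  obtains E where "countable E" "E \<subseteq> carrier G" "generate G V \<subseteq> E <#> K"
proof -
  have Kc: "K \<subseteq> carrier G" using K compactin_carrier by blast
  obtain F where F: "finite F" "F \<subseteq> carrier G" "K <#> K \<subseteq> F <#> V"
    using finite_cover[OF compactin_set_mult[OF K K] V(1)] V(2) by blast
  define E where "E = foldl (\<otimes>) \<one> ` lists F"
  have Ec: "foldl (\<otimes>) \<one> xs \<in> carrier G" if "xs \<in> lists F" for xs
    using that by (induction xs rule: rev_induct) (use F(2) in auto)
  have EF: "e \<otimes> f \<in> E" if e: "e \<in> E" and f: "f \<in> F" for e f
  proof -
    obtain xs where "xs \<in> lists F" "e = foldl (\<otimes>) \<one> xs" using e by (auto simp: E_def)
    then have "e \<otimes> f = foldl (\<otimes>) \<one> (xs @ [f])" "xs @ [f] \<in> lists F" using f by auto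
    then show ?thesis unfolding E_def by blast
  qed
  have "countable E"
    unfolding E_def by (intro countable_image countable_lists countable_finite F(1))
  moreover have "E \<subseteq> carrier G" using Ec by (auto simp: E_def)
  ultimately have E: "countable E" "E \<subseteq> carrier G" by blast+
  have step: "y \<otimes> v \<in> E <#> K" if y: "y \<in> E <#> K" and v: "v \<in> V" for y v
  proof -
    obtain e k where ek: "e \<in> E" "k \<in> K" "y = e \<otimes> k" using y by (auto simp: set_mult_def)
    have "k \<otimes> v \<in> F <#> V" using F(3) ek v V(3) unfolding set_mult_def by blast
    then obtain f w where fw: "f \<in> F" "w \<in> V" "k \<otimes> v = f \<otimes> w" by (auto simp: set_mult_def)
    have c: "e \<in> carrier G" "k \<in> carrier G" "v \<in> carrier G" "f \<in> carrier G" "w \<in> carrier G"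
      using ek v fw E F Kc V(3) by auto
    have "y \<otimes> v = (e \<otimes> f) \<otimes> w" using ek fw c by (simp add: m_assoc)
    then show ?thesis using EF[OF ek(1) fw(1)] fw(2) V(3) unfolding set_mult_def by blast
  qed
  have EKc: "E <#> K \<subseteq> carrier G" using E Kc by (intro set_mult_closed)
  have Vc: "V \<subseteq> carrier G" using V Kc by blast
  \<comment> \<open>With \<open>y\<close> quantified, the property is inherited by products, as the
    induction over generated elements requires.\<close>
  have gen: "\<forall>y\<in>E <#> K. y \<otimes> x \<in> E <#> K" if "x \<in> generate G V" for x
    using that
  proof induction
    case one
    then show ?case using EKc by auto
  next
    case (incl h)
    then show ?case using step by blast
  next
    case (inv h)
    then show ?case using step V(4) by blast
  next
    case (eng h1 h2)
    have c: "h1 \<in> carrier G" "h2 \<in> carrier G" using eng(1,2) generate_in_carrier[OF Vc] by auto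
    show ?case
    proof
      fix y assume y: "y \<in> E <#> K"
      then have "y \<otimes> (h1 \<otimes> h2) = (y \<otimes> h1) \<otimes> h2" using c EKc by (auto simp: m_assoc)
      then show "y \<otimes> (h1 \<otimes> h2) \<in> E <#> K" using eng y by simp
    qed
  qed
  have "\<one> \<in> E" unfolding E_def by (rule image_eqI[of _ _ "[]"]) auto
  moreover have "\<one> \<in> K" using V by blast
  ultimately have one: "\<one> \<in> E <#> K" unfolding set_mult_def by force
  have "generate G V \<subseteq> E <#> K"
  proof
    fix x assume x: "x \<in> generate G V"
    then have "\<one> \<otimes> x \<in> E <#> K" using gen one by blast
    then show "x \<in> E <#> K" using generate_in_carrier[OF Vc x] by simp
  qed
  then show ?thesis using that E by blast
qed

lemma openin_generate:
  assumes "openin T V" "\<one> \<in> V"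
  shows "openin T (generate G V)"
proof -
  have Vc: "V \<subseteq> carrier G" using assms openin_carrier by blast
  have "generate G V = (\<Union>h\<in>generate G V. h <# V)"
  proof
    show "(\<Union>h\<in>generate G V. h <# V) \<subseteq> generate G V"
      by (auto simp: l_coset_def intro: generate.eng generate.incl)
    show "generate G V \<subseteq> (\<Union>h\<in>generate G V. h <# V)"
    proof
      fix h assume h: "h \<in> generate G V"
      then have "h = h \<otimes> \<one>" using generate_in_carrier[OF Vc] by simp
      then have "h \<in> h <# V" using assms(2) unfolding l_coset_def by blast
      then show "h \<in> (\<Union>h\<in>generate G V. h <# V)" using h by blast
    qed
  qed
  moreover have "openin T (h <# V)" if "h \<in> generate G V" for h
    using openin_lcos[OF assms(1) generate_in_carrier[OF Vc that]] .
  then have "openin T (\<Union>h\<in>generate G V. h <# V)" by (intro openin_Union) auto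
  ultimately show ?thesis by simp
qed

text \<open>The index is counted by right cosets, while covering by left translates needs left ones;
  inverting the representatives exchanges the two.\<close>

lemma left_coset_representatives:
  assumes H: "subgroup H G"
  obtains R where "R \<subseteq> carrier G" "|R| \<le>o |rcosets H|" "carrier G \<subseteq> R <#> H"
proof -
  have "\<forall>C\<in>rcosets H. \<exists>g\<in>carrier G. C = H #> g" by (auto simp: RCOSETS_def)
  then obtain g where g: "\<And>C. C \<in> rcosets H \<Longrightarrow> g C \<in> carrier G" "\<And>C. C \<in> rcosets H \<Longrightarrow> C = H #> g C"
    by metis
  show ?thesis
  proof (rule that[of "(\<lambda>C. inv (g C)) ` (rcosets H)"])
    show "(\<lambda>C. inv (g C)) ` (rcosets H) \<subseteq> carrier G" using g(1) by auto
    show "|(\<lambda>C. inv (g C)) ` (rcosets H)| \<le>o |rcosets H|" by (rule card_of_image)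
    show "carrier G \<subseteq> (\<lambda>C. inv (g C)) ` (rcosets H) <#> H"
    proof
      fix x assume x: "x \<in> carrier G"
      let ?C = "H #> inv x"
      have C: "?C \<in> rcosets H" using x by (auto simp: RCOSETS_def)
      have "inv x \<in> H #> g ?C"
        using g(2)[OF C] rcos_self[OF _ H, of "inv x"] x by simp
      then obtain h where h: "h \<in> H" "inv x = h \<otimes> g ?C" by (auto simp: r_coset_def)
      have hc: "h \<in> carrier G" using h subgroup.subset[OF H] by blast
      have "x = inv (h \<otimes> g ?C)" using h(2) x by (metis inv_inv)
      also have "\<dots> = inv (g ?C) \<otimes> inv h" using hc g(1)[OF C] by (rule inv_mult_group)
      finally have "x = inv (g ?C) \<otimes> inv h" .
      moreover have "inv h \<in> H" using subgroup.m_inv_closed[OF H h(1)] .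
      ultimately show "x \<in> (\<lambda>C. inv (g C)) ` (rcosets H) <#> H"
        using C unfolding set_mult_def by blast
    qed
  qed
qed

lemma singleton_one_not_open:
  assumes "T \<noteq> discrete_topology (carrier G)"
  shows "\<not> openin T {\<one>}"
proof
  assume one: "openin T {\<one>}"
  have "openin T {g}" if "g \<in> carrier G" for g
    using openin_lcos[OF one that] that by (simp add: l_coset_def)
  then have "discrete_topology (carrier G) = T" by (simp add: discrete_topology_unique)
  then show False using assms by simp
qed

text \<open>Sets \<open>(r \<otimes> e) <# K\<close> cover the group and translates
  \<open>a <# C\<close> cover \<open>K\<close>, so the products
  \<open>(r \<otimes> e) \<otimes> a\<close> serve as translating elements. Each of the three
  factors ranges over at most cof(\<N>) elements, and this cardinal is infinite.\<close>

lemma nice_of_open_subgroup_index: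
  assumes nd: "T \<noteq> discrete_topology (carrier G)"
    and index: "\<And>H. subgroup H G \<Longrightarrow> openin T H \<Longrightarrow> |rcosets H| \<le>o cof_null"
  shows "nice G T"
proof -
  obtain \<mu> where \<mu>: "left_haar_measure G T \<mu>" using left_haar_measure_exists by blast
  interpret haar_group G T \<mu> by unfold_locales (rule \<mu>)
  obtain U K where U: "openin T U" "compactin T K" "\<one> \<in> U" "U \<subseteq> K"
    using compact_nbhd[OF openin_top one_closed] by metis
  obtain V where V: "openin T V" "\<one> \<in> V" "\<And>x. x \<in> V \<Longrightarrow> inv x \<in> V" "\<And>x y. x \<in> V \<Longrightarrow> y \<in> V \<Longrightarrow> x \<otimes> y \<in> U"
    using nbhd_split[OF U(1,3)] by metis
  have Vc: "V \<subseteq> carrier G" using V(1) openin_carrier by blast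
  have VK: "V \<subseteq> K"
  proof
    fix x assume x: "x \<in> V"
    then have "x \<otimes> \<one> \<in> U" using V by blast
    moreover have "x \<otimes> \<one> = x" using x Vc by (simp add: subset_iff)
    ultimately show "x \<in> K" using U(4) by auto
  qed
  obtain E where E: "countable E" "E \<subseteq> carrier G" "generate G V \<subseteq> E <#> K"
    using generated_countable_cover[OF U(2) V(1,2) VK V(3)] by metis
  have H: "subgroup (generate G V) G" using Vc by (rule generate_is_subgroup)
  obtain R where R: "R \<subseteq> carrier G" "|R| \<le>o |rcosets (generate G V)|" "carrier G \<subseteq> R <#> generate G V"
    using left_coset_representatives[OF H] by metis
  obtain C A where C: "compactin T C" "C \<in> null_sets \<mu>" "A \<subseteq> carrier G" "|A| \<le>o cof_null"
    "K \<subseteq> (\<Union>a\<in>A. a <# C)"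
    using null_compact_translates_cover[OF singleton_one_not_open[OF nd] U(2)] by metis
  have Cc: "C \<subseteq> carrier G" using C compactin_carrier by blast
  obtain \<H> where \<H>: "cofinal_null_family \<H>" "cof_null = |\<H>|"
    using cof_null_is_minimum(1) by blast
  let ?B = "(\<lambda>((r, e), a). (r \<otimes> e) \<otimes> a) ` ((R \<times> E) \<times> A)"
  have "|R| \<le>o |\<H>|"
    using R(2) index[OF H openin_generate[OF V(1,2)]] unfolding \<H>(2) by (rule ordLeq_transitive)
  moreover have "|E| \<le>o |\<H>|"
    using E(1) infinite_cofinal_null_family[OF \<H>(1)] by (rule countable_ordLeq_infinite)
  ultimately have "|(R \<times> E) \<times> A| \<le>o |\<H>|"
    using C(4) infinite_cofinal_null_family[OF \<H>(1)] unfolding \<H>(2)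
    by (intro Times_ordLeq_infinite)
  then have "|?B| \<le>o cof_null"
    unfolding \<H>(2) using card_of_image ordLeq_transitive by blast
  moreover have Bc: "?B \<subseteq> carrier G" using R(1) E(2) C(3) by auto
  moreover have "carrier G = (\<Union>b\<in>?B. b <# C)"
  proof
    show "(\<Union>b\<in>?B. b <# C) \<subseteq> carrier G" using Bc Cc l_coset_subset_G by blast
    show "carrier G \<subseteq> (\<Union>b\<in>?B. b <# C)"
    proof
      fix x assume "x \<in> carrier G"
      then obtain r h where rh: "r \<in> R" "h \<in> generate G V" "x = r \<otimes> h"
        using R(3) unfolding set_mult_def by blast
      then obtain e k where ek: "e \<in> E" "k \<in> K" "h = e \<otimes> k" using E(3) unfolding set_mult_def by blast
      then obtain a c where ac: "a \<in> A" "c \<in> C" "k = a \<otimes> c" using C(5) unfolding l_coset_def by blast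
      have "r \<in> carrier G" "e \<in> carrier G" "a \<in> carrier G" "c \<in> carrier G"
        using rh ek ac R E C Cc by auto
      then have x: "x = ((r \<otimes> e) \<otimes> a) \<otimes> c" using rh ek ac by (simp add: m_assoc)
      have "(r \<otimes> e) \<otimes> a \<in> ?B" using rh(1) ek(1) ac(1) by force
      moreover have "x \<in> ((r \<otimes> e) \<otimes> a) <# C" using x ac(2) unfolding l_coset_def by blast
      ultimately show "x \<in> (\<Union>b\<in>?B. b <# C)" by blast
    qed
  qed
  moreover have "haar_null G T C" using \<mu> C(2) by (auto simp: haar_null_def)
  ultimately show ?thesis using C(1) unfolding nice_def by blast
qed

end

theorem theorem3p1:
  fixes G :: "'a monoid" and T :: "'a topology"
  assumes profinite_nice:
      "\<And>(P :: 'a monoid) S. profinite_group P S \<Longrightarrow> infinite (carrier P) \<Longrightarrow> nice P S"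
    and "locally_compact_group G T"
    and "T \<noteq> discrete_topology (carrier G)"
    and "\<And>H. subgroup H G \<Longrightarrow> openin T H \<Longrightarrow> |rcosets\<^bsub>G\<^esub> H| \<le>o cof_null"
  shows "nice G T"
proof -
  have "group G" using assms(2) by (simp add: locally_compact_group_def topological_group_def)
  then interpret lc_group G T
    using assms(2) by (simp add: lc_group_def lc_group_axioms_def)
  show ?thesis using assms(3,4) by (rule nice_of_open_subgroup_index)
qed

end
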